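(* Let $F$ be an AM-space. Then: (i) $F$ is semicontinuous if and only if it isometrically embeds as a regular sublattice of $C(K)$, for some compact Hausdorff space $K$. (ii) $F$ is demicontinuous if and only if it isomorphically embeds as a regular sublattice of $C(K)$, for some compact Hausdorff space $K$. In this case it is topologically semicontinuous. (iii) $F$ is pointwise demicontinuous if and only if it injectively embeds as a regular sublattice of $C(K)$, for some compact Hausdorff space $K$. Moreover, in each of (i)–(iii) "regular" can be replaced with "order dense", while $K$ can be assumed extremally disconnected.
   Context: An AM-space is a norm complete normed lattice (real vector lattice with a solid norm) such that $\|e\vee f\|=\max(\|e\|,\|f\|)$ for all $e,f\ge 0$. $C(K)$ is the Banach lattice of real continuous functions on $K$ with the supremum norm. $P\uparrow f$ means that $P$ is upward directed with supremum $f$. $B_F$ is the closed unit ball of $F$ and $B_{F_+}=B_F\cap F_+$. For $r\ge1$, $F$ is $r$-demicontinuous if whenever $P\subset B_{F_+}$ and $f\in F$ satisfy $P\uparrow f$, then $\|f\|\le r$; $F$ is semicontinuous if it is $1$-demicontinuous, and demicontinuous if it is $r$-demicontinuous for some $r\ge 1$. $F$ is topologically semicontinuous if it has an equivalent semicontinuous solid norm. $F$ is pointwise demicontinuous if for every $0<f\in F$ there is $t>0$ such that whenever $P\subset sB_{F_+}$ satisfies $P\uparrow f$, then $s\ge t$. A sublattice $E$ of a vector lattice $G$ is order dense if for every $0<g\in G$ there is $e\in E$ with $0<e\le g$; it is regular if whenever $P\subset E$ has infimum $0$ in $E$, it has infimum $0$ in $G$. $F$ embeds injectively (isomorphically, isometrically)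 as a sublattice with a given property if there is an injective linear lattice homomorphism $F\to C(K)$ (respectively, one that is in addition bounded and bounded below in norm, or isometric) whose image has that property. *)

theory Defs
  imports
    "HOL-Analysis.Analysis"
    "HOL-Library.Lattice_Algebras"
    "HOL-Library.Function_Algebras"
    "HOL-Library.Lub_Glb"
begin

section \<open>Vector lattices and AM-spaces\<close>

class vector_lattice = ordered_real_vector + lattice

class am_space = banach + vector_lattice + lattice_ab_group_add_abs +
  assumes norm_solid: "\<bar>x\<bar> \<le> \<bar>y\<bar> \<Longrightarrow> norm x \<le> norm y"
    and norm_sup: "0 \<le> e \<Longrightarrow> 0 \<le> f \<Longrightarrow> norm (sup e f) = max (norm e) (norm f)"

text \<open>Real functions form a vector lattice under the pointwise operations and the pointwise order;
  the additive group structure is the one of \<^theory>\<open>HOL-Library.Function_Algebras\<close>.\<close>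

instantiation "fun" :: (type, real_vector) real_vector
begin

definition scaleR_fun :: "real \<Rightarrow> ('a \<Rightarrow> 'b) \<Rightarrow> 'a \<Rightarrow> 'b"
  where "scaleR_fun c g = (\<lambda>x. c *\<^sub>R g x)"

instance
  by standard
    (auto simp: scaleR_fun_def plus_fun_def scaleR_add_right scaleR_add_left)

end

instance "fun" :: (type, vector_lattice) vector_lattice
  by standard
    (auto simp: scaleR_fun_def le_fun_def zero_fun_def
      intro: scaleR_left_mono scaleR_right_mono)

instance real :: vector_lattice ..

definition lattice_hom :: "('a::vector_lattice \<Rightarrow> 'b::vector_lattice) \<Rightarrow> bool"
  where "lattice_hom T \<longleftrightarrow> linear T \<and>
    (\<forall>f g. T (sup f g) = sup (T f) (T g)) \<and> (\<forall>f g. T (inf f g) = inf (T f) (T g))"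

definition sublattice :: "'b::vector_lattice set \<Rightarrow> 'b set \<Rightarrow> bool"
  where "sublattice E G \<longleftrightarrow> E \<subseteq> G \<and> subspace E \<and>
    (\<forall>f\<in>E. \<forall>g\<in>E. sup f g \<in> E \<and> inf f g \<in> E)"

definition order_dense_sublattice :: "'b::vector_lattice set \<Rightarrow> 'b set \<Rightarrow> bool"
  where "order_dense_sublattice E G \<longleftrightarrow> sublattice E G \<and>
    (\<forall>g\<in>G. 0 < g \<longrightarrow> (\<exists>e\<in>E. 0 < e \<and> e \<le> g))"

text \<open>The set \<open>P\<close> is required to be nonempty: the infimum of the empty set would be a greatest
  element, which exists in \<open>E\<close> only if \<open>E = {0}\<close>.\<close>

definition regular_sublattice :: "'b::vector_lattice set \<Rightarrow> 'b set \<Rightarrow> bool"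
  where "regular_sublattice E G \<longleftrightarrow> sublattice E G \<and>
    (\<forall>P. P \<noteq> {} \<and> P \<subseteq> E \<and> isGlb E P 0 \<longrightarrow> isGlb G P 0)"

section \<open>Semicontinuity and its relatives\<close>

definition directed_up_to :: "'a::order set \<Rightarrow> 'a \<Rightarrow> bool"  (infix \<open>\<up>\<close> 50)
  where "P \<up> f \<longleftrightarrow> P \<noteq> {} \<and> (\<forall>p\<in>P. \<forall>q\<in>P. \<exists>r\<in>P. p \<le> r \<and> q \<le> r) \<and> isLub UNIV P f"

text \<open>The norm is an explicit argument \<open>N\<close>, because topological semicontinuity concerns
  renormings of the same vector lattice.\<close>

definition pos_ball :: "('a::vector_lattice \<Rightarrow> real) \<Rightarrow> 'a set"
  where "pos_ball N = {f. N f \<le> 1 \<and> 0 \<le> f}"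

definition r_demicontinuous :: "real \<Rightarrow> ('a::vector_lattice \<Rightarrow> real) \<Rightarrow> bool"
  where "r_demicontinuous r N \<longleftrightarrow> (\<forall>P f. P \<subseteq> pos_ball N \<and> P \<up> f \<longrightarrow> N f \<le> r)"

definition semicontinuous :: "('a::vector_lattice \<Rightarrow> real) \<Rightarrow> bool"
  where "semicontinuous N \<longleftrightarrow> r_demicontinuous 1 N"

definition demicontinuous :: "('a::vector_lattice \<Rightarrow> real) \<Rightarrow> bool"
  where "demicontinuous N \<longleftrightarrow> (\<exists>r\<ge>1. r_demicontinuous r N)"

definition pointwise_demicontinuous :: "('a::vector_lattice \<Rightarrow> real) \<Rightarrow> bool"
  where "pointwise_demicontinuous N \<longleftrightarrow>
    (\<forall>f>0. \<exists>t>0. \<forall>P s. P \<subseteq> (\<lambda>p. s *\<^sub>R p) ` pos_ball N \<and> P \<up> f \<longrightarrow> s \<ge> t)"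

definition is_norm :: "('a::real_vector \<Rightarrow> real) \<Rightarrow> bool"
  where "is_norm N \<longleftrightarrow> (\<forall>f. N f \<ge> 0) \<and> (\<forall>f. N f = 0 \<longleftrightarrow> f = 0) \<and>
    (\<forall>f g. N (f + g) \<le> N f + N g) \<and> (\<forall>c f. N (c *\<^sub>R f) = \<bar>c\<bar> * N f)"

definition solid_norm :: "('a::{vector_lattice, abs} \<Rightarrow> real) \<Rightarrow> bool"
  where "solid_norm N \<longleftrightarrow> is_norm N \<and> (\<forall>f g. \<bar>f\<bar> \<le> \<bar>g\<bar> \<longrightarrow> N f \<le> N g)"

definition equivalent_norms :: "('a \<Rightarrow> real) \<Rightarrow> ('a \<Rightarrow> real) \<Rightarrow> bool"
  where "equivalent_norms N M \<longleftrightarrow> (\<exists>a>0. \<exists>b>0. \<forall>f. a * N f \<le> M f \<and> M f \<le> b * N f)"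

definition topologically_semicontinuous :: "('a::{vector_lattice, abs} \<Rightarrow> real) \<Rightarrow> bool"
  where "topologically_semicontinuous N \<longleftrightarrow>
    (\<exists>M. solid_norm M \<and> equivalent_norms N M \<and> semicontinuous M)"

section \<open>The space $C(K)$ and embeddings into it\<close>

text \<open>A continuous function on the space \<open>K\<close> is represented by a function on the whole type that
  vanishes off \<^term>\<open>topspace K\<close>, so that distinct representatives are distinct functions on \<open>K\<close>
  and the pointwise operations and order on functions restrict to those of $C(K)$.\<close>

definition CK :: "'k topology \<Rightarrow> ('k \<Rightarrow> real) set"
  where "CK K = {g. continuous_map K euclideanreal g \<and> (\<forall>x. x \<notin> topspace K \<longrightarrow> g x = 0)}"

text \<open>The case distinction is needed because \<^term>\<open>Sup {} :: real\<close> is unspecified.\<close>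

definition sup_norm :: "'k topology \<Rightarrow> ('k \<Rightarrow> real) \<Rightarrow> real"
  where "sup_norm K g = (if topspace K = {} then 0 else (SUP x\<in>topspace K. \<bar>g x\<bar>))"

definition extremally_disconnected :: "'k topology \<Rightarrow> bool"
  where "extremally_disconnected K \<longleftrightarrow> (\<forall>U. openin K U \<longrightarrow> openin K (K closure_of U))"

definition embedding :: "'k topology \<Rightarrow> ('a::vector_lattice \<Rightarrow> 'k \<Rightarrow> real) \<Rightarrow> bool"
  where "embedding K T \<longleftrightarrow> lattice_hom T \<and> inj T \<and> range T \<subseteq> CK K"

text \<open>In the following definitions \<open>R\<close> is a property of a subset of a vector lattice,
  such as \<^const>\<open>regular_sublattice\<close> or \<^const>\<open>order_dense_sublattice\<close>.\<close>

definition injectively_embeds ::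
    "'a::am_space itself \<Rightarrow> (('k \<Rightarrow> real) set \<Rightarrow> ('k \<Rightarrow> real) set \<Rightarrow> bool) \<Rightarrow> 'k topology \<Rightarrow> bool"
  where "injectively_embeds F R K \<longleftrightarrow>
    (\<exists>T :: 'a \<Rightarrow> 'k \<Rightarrow> real. embedding K T \<and> R (range T) (CK K))"

definition isomorphically_embeds ::
    "'a::am_space itself \<Rightarrow> (('k \<Rightarrow> real) set \<Rightarrow> ('k \<Rightarrow> real) set \<Rightarrow> bool) \<Rightarrow> 'k topology \<Rightarrow> bool"
  where "isomorphically_embeds F R K \<longleftrightarrow>
    (\<exists>T :: 'a \<Rightarrow> 'k \<Rightarrow> real. embedding K T \<and>
      (\<exists>a>0. \<exists>b>0. \<forall>f. a * norm f \<le> sup_norm K (T f) \<and> sup_norm K (T f) \<le> b * norm f) \<and>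
      R (range T) (CK K))"

definition isometrically_embeds ::
    "'a::am_space itself \<Rightarrow> (('k \<Rightarrow> real) set \<Rightarrow> ('k \<Rightarrow> real) set \<Rightarrow> bool) \<Rightarrow> 'k topology \<Rightarrow> bool"
  where "isometrically_embeds F R K \<longleftrightarrow>
    (\<exists>T :: 'a \<Rightarrow> 'k \<Rightarrow> real. embedding K T \<and>
      (\<forall>f. sup_norm K (T f) = norm f) \<and>
      R (range T) (CK K))"

text \<open>Since one cannot quantify existentially over types, the existence of a compact Hausdorff space
  \<open>K\<close> is stated for spaces with points in \<open>'a set set\<close>, where \<open>'a\<close> is the type of the AM-space.
  This type is large enough: if the AM-space is order dense in $C(K)$ with \<open>K\<close> extremally
  disconnected, then \<open>K\<close> is homeomorphic to the Stone space of its Boolean algebra of bands,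
  whose points (ultrafilters of bands) are elements of \<open>'a set set\<close>.\<close>

end

theory Submission
  imports Defs
begin

text \<open>
  Let \<open>e\<close> be the ideal supremum of the positive part of the unit ball of \<open>F\<close>. The AM-property makes
  \<open>{inf f (l b) | b}\<close>, \<open>b\<close> in that part of the ball, upward directed, so \<open>f \<le> l e\<close> can be read as
  \<open>{inf f (l b) | b} \<up> f\<close>. The points of \<open>K\<close> are the ultrafilters of bands, and
  \<open>f \<mapsto> f / e\<close> is evaluated at \<open>x\<close> as the supremum of those \<open>l\<close> for which the band on which
  \<open>f \<ge> l e\<close> belongs to \<open>x\<close>. This single map serves all three cases: pointwise demicontinuity makes
  it injective, and \<open>r\<close>-demicontinuity makes it bounded below by \<open>1 / r\<close>.

  Conversely, a regular embedding takes a supremum of elements of the unit ball to a supremum of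
  functions bounded by a constant.
\<close>

section \<open>Polars\<close>

text \<open>The unit \<open>e\<close> exists only ideally: \<open>F\<close> need not contain it and
  need not be order complete, so no quotient by \<open>e\<close> can be formed inside
  \<open>F\<close>. The construction stays with bands instead, encoded as polars (disjoint
  complements). In a normed lattice, which is Archimedean, these are exactly the bands, and they
  form a complete Boolean algebra whatever suprema \<open>F\<close> has; that completeness makes
  \<open>K\<close> extremally disconnected. The band on which \<open>f \<ge> l e\<close> is the
  disjoint complement of all positive parts of \<open>l b - f\<close>. The delicate half of
  linearity is that values do not exceed their sum: witnesses \<open>b\<close> for
  \<open>f < l b\<close> and \<open>c\<close> for \<open>g < m c\<close> must be merged into one,
  and \<open>sup b c\<close> stays in the ball by the AM-property. All constants come from one fact:
  for \<open>f \<ge> 0\<close> and \<open>l\<close> above the sup norm of the image of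
  \<open>f\<close>, the truncations of \<open>f\<close> lie in \<open>l\<close> times the ball and
  increase to \<open>f\<close>. Hence \<open>norm f \<le> r * l\<close> in the demicontinuous case,
  and \<open>l = t / 2\<close> is excluded in the pointwise one. Norm completeness enters in the
  converse of the injective case: no bound on the embedding is assumed there, and completeness
  forces one.\<close>

lemma inf_add_le:
  fixes u v w :: "'a::lattice_ab_group_add"
  assumes "0 \<le> u" "0 \<le> v" "0 \<le> w"
  shows "inf (u + v) w \<le> inf u w + inf v w"
proof -
  define m where "m = inf (u + v) w"
  have m: "m \<le> u + v" "m \<le> w" by (simp_all add: m_def)
  have "m \<le> w + v" using m(2) \<open>0 \<le> v\<close> by (simp add: add_increasing2)
  then have "m - v \<le> inf u w" using m by (simp add: diff_le_eq)
  then have 1: "m - inf u w \<le> v" by (metis diff_le_eq add.commute)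
  have "m \<le> w + inf u w" using m(2) assms by (simp add: add_increasing2)
  then have "m - inf u w \<le> w" by (metis diff_le_eq)
  then have "m - inf u w \<le> inf v w" using 1 by (rule le_infI[rotated])
  then show ?thesis unfolding m_def by (metis diff_le_eq add.commute)
qed

lemma inf_mono_0:
  fixes u v :: "'a::lattice_ab_group_add"
  assumes "inf u v = 0" "0 \<le> u'" "0 \<le> v'" "u' \<le> u" "v' \<le> v"
  shows "inf u' v' = 0"
  using assms by (metis antisym inf_mono inf_greatest)

lemma abs_inf_0_0 [simp]:
  fixes k :: "'a::lattice_ab_group_add_abs"
  shows "inf \<bar>k\<bar> 0 = 0" "inf 0 \<bar>k\<bar> = 0"
  by (simp_all add: inf_absorb1 inf_absorb2)

text \<open>The disjoint complement. Bands are encoded as sets of this form because complementation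
  needs no suprema in the lattice.\<close>

definition polar :: "'a::lattice_ab_group_add_abs set \<Rightarrow> 'a set"
  where "polar S = {k. \<forall>s\<in>S. inf \<bar>k\<bar> \<bar>s\<bar> = 0}"

definition polars :: "'a::lattice_ab_group_add_abs set set"
  where "polars = range polar"

lemma polar_in_polars [simp, intro]: "polar S \<in> polars"
  by (simp add: polars_def)

lemma zero_in_polar: "0 \<in> polar S"
  by (simp add: polar_def)

lemma zero_in_polars: "A \<in> polars \<Longrightarrow> 0 \<in> A"
  using zero_in_polar by (auto simp: polars_def)

lemma zero_in_Inter_polars: "Y \<subseteq> polars \<Longrightarrow> 0 \<in> \<Inter>Y"
  using zero_in_polars by (metis InterI subsetD)

lemma polar_antimono: "S \<subseteq> T \<Longrightarrow> polar T \<subseteq> polar S"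
  by (auto simp: polar_def)

lemma subset_polar_polar: "S \<subseteq> polar (polar S)"
  by (auto simp: polar_def inf_commute)

text \<open>\<open>polar\<close> is a Galois connection with itself, so its third iterate is the
  first one.\<close>

lemma polar_polar_polars: "A \<in> polars \<Longrightarrow> polar (polar A) = A"
proof -
  assume "A \<in> polars"
  then obtain S where S: "A = polar S" by (auto simp: polars_def)
  show "polar (polar A) = A" unfolding S
    by (intro subset_antisym polar_antimono subset_polar_polar)
qed

lemma polars_solid:
  assumes "A \<in> polars" "l \<in> A" "\<bar>k\<bar> \<le> \<bar>l\<bar>"
  shows "k \<in> A"
proof -
  obtain S where S: "A = polar S" using assms by (auto simp: polars_def)
  show ?thesis unfolding S polar_def
  proof safe
    fix s assume "s \<in> S"
    then have "inf \<bar>l\<bar> \<bar>s\<bar> = 0" using assms S by (auto simp: polar_def)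
    then show "inf \<bar>k\<bar> \<bar>s\<bar> = 0" by (rule inf_mono_0) (use assms in auto)
  qed
qed

text \<open>Completeness of the algebra: since each \<open>A\<close> is the complement of
  \<open>polar A\<close>, the intersection is the complement of the union of the
  complements.\<close>

lemma polars_Inter: "Y \<subseteq> polars \<Longrightarrow> \<Inter>Y \<in> polars"
proof -
  assume Y: "Y \<subseteq> polars"
  have "\<Inter>Y = polar (\<Union>A\<in>Y. polar A)"
  proof
    show "\<Inter>Y \<subseteq> polar (\<Union>A\<in>Y. polar A)"
      by (auto simp: polar_def) (metis inf_commute)
    have "polar (\<Union>A\<in>Y. polar A) \<subseteq> A" if "A \<in> Y" for A
      using polar_antimono[of "polar A" "\<Union>A\<in>Y. polar A"] polar_polar_polars[of A] that Y by blast
    then show "polar (\<Union>A\<in>Y. polar A) \<subseteq> \<Inter>Y" by blast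
  qed
  then show ?thesis by simp
qed

lemma polars_Int: "A \<in> polars \<Longrightarrow> B \<in> polars \<Longrightarrow> A \<inter> B \<in> polars"
  using polars_Inter[of "{A, B}"] by simp

lemma Int_polar: "A \<in> polars \<Longrightarrow> A \<inter> polar A = {0}"
proof -
  assume A: "A \<in> polars"
  have "k = 0" if "k \<in> A" "k \<in> polar A" for k
  proof -
    have "inf \<bar>k\<bar> \<bar>k\<bar> = 0" using that unfolding polar_def by blast
    then show ?thesis by simp
  qed
  then show ?thesis using zero_in_polar[of A] zero_in_polars[OF A] by blast
qed

text \<open>By solidity \<open>inf \<bar>a\<bar> \<bar>b\<bar>\<close> lies in both polars, hence is
  \<open>0\<close>. Together with \<open>Int_polar\<close> this makes \<open>polar\<close> the
  Boolean complement, with \<open>{0}\<close> as bottom.\<close>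

lemma disjoint_subset_polar:
  assumes "A \<in> polars" "B \<in> polars" "A \<inter> B \<subseteq> {0}"
  shows "A \<subseteq> polar B"
proof
  fix a assume a: "a \<in> A"
  show "a \<in> polar B" unfolding polar_def
  proof safe
    fix b assume b: "b \<in> B"
    have "\<bar>inf \<bar>a\<bar> \<bar>b\<bar>\<bar> = inf \<bar>a\<bar> \<bar>b\<bar>" by (intro abs_of_nonneg) simp
    then have "inf \<bar>a\<bar> \<bar>b\<bar> \<in> A" "inf \<bar>a\<bar> \<bar>b\<bar> \<in> B"
      using polars_solid[OF assms(1) a] polars_solid[OF assms(2) b] by simp_all
    then show "inf \<bar>a\<bar> \<bar>b\<bar> = 0" using assms by blast
  qed
qed

section \<open>The Stone space of the algebra of polars\<close>

text \<open>The finite intersection property in the algebra of polars. The empty \<open>Y\<close>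
  demands \<open>UNIV \<noteq> {0}\<close>, so over the zero lattice nothing is centered and the
  Stone space is empty.\<close>

definition centered :: "'a::lattice_ab_group_add_abs set set \<Rightarrow> bool"
  where "centered X \<longleftrightarrow> X \<subseteq> polars \<and> (\<forall>Y. finite Y \<and> Y \<subseteq> X \<longrightarrow> \<Inter>Y \<noteq> {0})"

text \<open>Ultrafilters, taken as maximal centered families: existence is then an application of
  Zorn's lemma, and the filter properties follow from maximality.\<close>

definition stone_points :: "'a::lattice_ab_group_add_abs set set set"
  where "stone_points = {x. centered x \<and> (\<forall>y. centered y \<longrightarrow> x \<subseteq> y \<longrightarrow> y = x)}"

text \<open>Zorn's lemma applies because a finite subfamily of the union of a chain already lies in
  one member of the chain.\<close>

lemma centered_extends:
  assumes "centered X"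
  shows "\<exists>x\<in>stone_points. X \<subseteq> x"
proof -
  let ?A = "{y. centered y \<and> X \<subseteq> y}"
  have "\<exists>M\<in>?A. \<forall>y\<in>?A. M \<subseteq> y \<longrightarrow> y = M"
  proof (rule subset_Zorn_nonempty)
    show "?A \<noteq> {}" using assms by blast
  next
    fix C assume C: "C \<noteq> {}" "subset.chain ?A C"
    have "centered (\<Union>C)" unfolding centered_def
    proof (intro conjI allI impI)
      show "\<Union>C \<subseteq> polars" using C by (auto simp: subset.chain_def centered_def)
      fix Y assume Y: "finite Y \<and> Y \<subseteq> \<Union>C"
      have "\<exists>y\<in>C. Y \<subseteq> y"
        using Y C finite_subset_Union_chain by metis
      then show "\<Inter>Y \<noteq> {0}" using Y C by (auto simp: subset.chain_def centered_def)
    qed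
    moreover have "X \<subseteq> \<Union>C"
    proof -
      obtain c where c: "c \<in> C" using C(1) by (meson ex_in_conv)
      then have "c \<in> ?A" using subset.chain_def[of ?A C] C(2) by (meson subsetD)
      then have "X \<subseteq> c" by simp
      then show ?thesis using c by (meson Union_upper subset_trans)
    qed
    ultimately show "\<Union>C \<in> ?A" by simp
  qed
  then obtain M where M: "M \<in> ?A" "\<forall>y\<in>?A. M \<subseteq> y \<longrightarrow> y = M" by (elim bexE)
  then have "y = M" if "centered y" "M \<subseteq> y" for y
    using that M by (metis (mono_tags, lifting) mem_Collect_eq subset_trans)
  then have "M \<in> stone_points" using M(1) by (simp add: stone_points_def)
  then show ?thesis using M(1) by (intro bexI[of _ M]) simp_all
qed

text \<open>Points separate nonzero bands from \<open>{0}\<close>: a band contained in no point must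
  be trivial.\<close>

lemma polar_extends:
  assumes "A \<in> polars" "A \<noteq> {0}"
  shows "\<exists>x\<in>stone_points. A \<in> x"
proof -
  have "Y = {} \<or> Y = {A}" if "Y \<subseteq> {A}" for Y using that by blast
  moreover have "UNIV \<noteq> {0::'a}" using assms(2) zero_in_polars[OF assms(1)] by blast
  ultimately have "\<Inter>Y \<noteq> {0}" if "Y \<subseteq> {A}" for Y using that assms(2) by (metis Inter_empty cInf_singleton)
  then have "centered {A}" using assms(1) unfolding centered_def by simp
  then show ?thesis using centered_extends by blast
qed

context
  fixes x :: "'a::lattice_ab_group_add_abs set set"
  assumes x: "x \<in> stone_points"
begin

lemma stone_point_centered: "centered x"
  using x by (simp add: stone_points_def)

lemma stone_point_polars: "A \<in> x \<Longrightarrow> A \<in> polars"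
  using stone_point_centered by (auto simp: centered_def)

lemma stone_point_Inter: "finite Y \<Longrightarrow> Y \<subseteq> x \<Longrightarrow> \<Inter>Y \<noteq> {0}"
  using stone_point_centered by (auto simp: centered_def)

text \<open>Under the assumption \<open>insert A x\<close> is still centered, so maximality of
  \<open>x\<close> forces \<open>A\<close> into it. The closure properties of a point are all
  reduced to this test.\<close>

lemma stone_pointI:
  assumes A: "A \<in> polars" and Y: "\<And>Y. finite Y \<Longrightarrow> Y \<subseteq> x \<Longrightarrow> \<Inter>Y \<inter> A \<noteq> {0}"
  shows "A \<in> x"
proof -
  have "centered (insert A x)" unfolding centered_def
  proof (intro conjI allI impI)
    show sub: "insert A x \<subseteq> polars" using A stone_point_polars by auto
    fix Z assume Z: "finite Z \<and> Z \<subseteq> insert A x"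
    then have *: "\<Inter>(Z - {A}) \<inter> A \<noteq> {0}" by (intro Y) auto
    have "0 \<in> \<Inter>(Z - {A}) \<inter> A"
      using Z sub zero_in_polars[OF A] zero_in_Inter_polars[of "Z - {A}"] by blast
    moreover have "\<Inter>(Z - {A}) \<inter> A \<subseteq> \<Inter>Z" by blast
    ultimately show "\<Inter>Z \<noteq> {0}" using * by blast
  qed
  then have "insert A x = x" using x by (auto simp: stone_points_def)
  then show ?thesis by blast
qed

lemma stone_point_mono:
  assumes "A \<in> x" "B \<in> polars" "A \<subseteq> B"
  shows "B \<in> x"
proof (rule stone_pointI)
  fix Y assume Y: "finite Y" "Y \<subseteq> x"
  then have *: "\<Inter>(insert A Y) \<noteq> {0}" using assms by (intro stone_point_Inter) auto
  have "insert A Y \<subseteq> polars" using Y assms(1) stone_point_polars by blast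
  then have "0 \<in> \<Inter>(insert A Y)" by (rule zero_in_Inter_polars)
  then show "\<Inter>Y \<inter> B \<noteq> {0}" using * assms by auto
qed fact

lemma stone_point_Int:
  assumes "A \<in> x" "B \<in> x"
  shows "A \<inter> B \<in> x"
proof (rule stone_pointI)
  fix Y assume Y: "finite Y" "Y \<subseteq> x"
  then have "\<Inter>(insert A (insert B Y)) \<noteq> {0}" using assms by (intro stone_point_Inter) auto
  then show "\<Inter>Y \<inter> (A \<inter> B) \<noteq> {0}" by (simp add: Int_ac)
next
  show "A \<inter> B \<in> polars" using assms stone_point_polars by (intro polars_Int)
qed

lemma stone_point_nonzero: "A \<in> x \<Longrightarrow> A \<noteq> {0}"
  using stone_point_Inter[of "{A}"] by simp

text \<open>The ultrafilter dichotomy. If \<open>A\<close> is missing from \<open>x\<close>, some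
  finite intersection of members of \<open>x\<close> meets \<open>A\<close> only in
  \<open>0\<close>; that intersection lies in \<open>polar A\<close>, which is therefore compatible
  with \<open>x\<close>.\<close>

lemma stone_point_polar_iff:
  assumes A: "A \<in> polars"
  shows "polar A \<in> x \<longleftrightarrow> A \<notin> x"
proof
  assume "polar A \<in> x"
  then show "A \<notin> x"
    using stone_point_Int[of A "polar A"] stone_point_nonzero Int_polar[OF A] by auto
next
  assume "A \<notin> x"
  have "\<exists>Y. finite Y \<and> Y \<subseteq> x \<and> \<Inter>Y \<inter> A = {0}"
  proof (rule ccontr)
    assume "\<nexists>Y. finite Y \<and> Y \<subseteq> x \<and> \<Inter>Y \<inter> A = {0}"
    then have "A \<in> x" by (intro stone_pointI[OF A]) auto
    then show False using \<open>A \<notin> x\<close> by blast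
  qed
  then obtain Y where Y: "finite Y" "Y \<subseteq> x" "\<Inter>Y \<inter> A = {0}" by metis
  have "\<Inter>Y \<in> polars" using Y stone_point_polars by (intro polars_Inter) auto
  then have sub: "\<Inter>Y \<subseteq> polar A" using disjoint_subset_polar[of "\<Inter>Y" A] A Y by simp
  show "polar A \<in> x"
  proof (rule stone_pointI)
    fix Z assume Z: "finite Z" "Z \<subseteq> x"
    then have *: "\<Inter>(Y \<union> Z) \<noteq> {0}" using Y by (intro stone_point_Inter) auto
    have "Y \<union> Z \<subseteq> polars" using Y(2) Z(2) stone_point_polars by blast
    then have "0 \<in> \<Inter>(Y \<union> Z)" by (rule zero_in_Inter_polars)
    moreover have "\<Inter>(Y \<union> Z) \<subseteq> \<Inter>Z \<inter> polar A" using sub by auto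
    ultimately show "\<Inter>Z \<inter> polar A \<noteq> {0}" using * by (metis subset_singletonD empty_iff)
  qed simp
qed

lemma stone_point_UNIV: "UNIV \<in> x"
proof (rule stone_pointI)
  show "UNIV \<in> (polars :: 'a set set)" using polars_Inter[of "{}"] by simp
qed (use stone_point_Inter in auto)

end

text \<open>The sets of points containing a given polar form a base, as \<open>A \<inter> B\<close>
  belongs to a point exactly when both \<open>A\<close> and \<open>B\<close> do; so openness can be
  tested at each point.\<close>

definition stone_space :: "'a::lattice_ab_group_add_abs set set topology"
  where "stone_space = topology (\<lambda>U. U \<subseteq> stone_points \<and>
    (\<forall>x\<in>U. \<exists>A\<in>x. {y\<in>stone_points. A \<in> y} \<subseteq> U))"

lemma openin_stone_space:
  "openin stone_space U \<longleftrightarrow> U \<subseteq> stone_points \<and>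
    (\<forall>x\<in>U. \<exists>A\<in>x. {y\<in>stone_points. A \<in> y} \<subseteq> U)"
proof -
  let ?L = "\<lambda>U::'a set set set. U \<subseteq> stone_points \<and> (\<forall>x\<in>U. \<exists>A\<in>x. {y\<in>stone_points. A \<in> y} \<subseteq> U)"
  have "istopology ?L" unfolding istopology_def
  proof (intro conjI allI impI)
    fix S T assume S: "?L S" and T: "?L T"
    show "S \<inter> T \<subseteq> stone_points" using S by blast
    show "\<forall>x\<in>S \<inter> T. \<exists>A\<in>x. {y \<in> stone_points. A \<in> y} \<subseteq> S \<inter> T"
    proof
      fix x assume x: "x \<in> S \<inter> T"
      obtain A where A: "A \<in> x" "{y\<in>stone_points. A \<in> y} \<subseteq> S" using S x by (elim conjE IntE) blast
      obtain B where B: "B \<in> x" "{y\<in>stone_points. B \<in> y} \<subseteq> T" using T x by (elim conjE IntE) blast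
      have xs: "x \<in> stone_points" using S x by blast
      have "A \<in> y \<and> B \<in> y" if "y \<in> stone_points" "A \<inter> B \<in> y" for y
        using stone_point_mono[OF that] stone_point_polars[OF xs] A(1) B(1) by simp
      moreover have "A \<inter> B \<in> x" using stone_point_Int[OF xs A(1) B(1)] .
      ultimately show "\<exists>A\<in>x. {y \<in> stone_points. A \<in> y} \<subseteq> S \<inter> T"
        using A(2) B(2) by (intro bexI[of _ "A \<inter> B"]) auto
    qed
  next
    fix \<K> assume \<K>: "\<forall>K\<in>\<K>. ?L K"
    show "\<Union>\<K> \<subseteq> stone_points"
      using \<K> by (meson Union_least)
    show "\<forall>x\<in>\<Union>\<K>. \<exists>A\<in>x. {y \<in> stone_points. A \<in> y} \<subseteq> \<Union>\<K>"
      using \<K> by (meson Union_iff Union_upper subset_trans)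
  qed
  then show ?thesis unfolding stone_space_def by (simp add: topology_inverse')
qed

lemma openin_stone_space_basic:
  "openin stone_space {y\<in>stone_points. A \<in> y}"
  by (auto simp: openin_stone_space)

lemma topspace_stone_space: "topspace stone_space = (stone_points :: 'a::lattice_ab_group_add_abs set set set)"
proof -
  have "openin stone_space (stone_points :: 'a set set set)"
    unfolding openin_stone_space using stone_point_UNIV by blast
  then show ?thesis
    using openin_stone_space openin_subset openin_topspace by (metis subset_antisym)
qed

text \<open>Distinct maximal families are not nested, so some \<open>A\<close> belongs to
  \<open>x\<close> only; the basic sets of \<open>A\<close> and of its complement separate the
  points.\<close>

lemma Hausdorff_stone_space: "Hausdorff_space stone_space"
  unfolding Hausdorff_space_def topspace_stone_space
proof (intro allI impI)
  fix x y :: "'a set set" assume xy: "x \<in> stone_points \<and> y \<in> stone_points \<and> x \<noteq> y"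
  then have "\<not> x \<subseteq> y" by (auto simp: stone_points_def)
  then obtain A where A: "A \<in> x" "A \<notin> y" by blast
  have A': "A \<in> polars" using A xy stone_point_polars by blast
  show "\<exists>U V. openin stone_space U \<and> openin stone_space V \<and> x \<in> U \<and> y \<in> V \<and> disjnt U V"
  proof (intro exI conjI)
    show "openin stone_space {y\<in>stone_points. A \<in> y}" "openin stone_space {y\<in>stone_points. polar A \<in> y}"
      by (rule openin_stone_space_basic)+
    show "disjnt {y\<in>stone_points. A \<in> y} {y\<in>stone_points. polar A \<in> y}"
      using stone_point_polar_iff A' by (auto simp: disjnt_def)
  qed (use A xy stone_point_polar_iff A' in auto)
qed

lemma compact_stone_space: "compact_space (stone_space :: 'a::lattice_ab_group_add_abs set set topology)"
  unfolding compact_space_alt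
proof (intro allI impI)
  fix \<U> :: "'a set set set set"
  assume "(\<forall>U\<in>\<U>. openin stone_space U) \<and> topspace stone_space \<subseteq> \<Union>\<U>"
  then have op: "\<forall>U\<in>\<U>. openin stone_space U" and cov: "topspace stone_space \<subseteq> \<Union>\<U>" by simp_all
  \<comment> \<open>The bands whose basic sets fit into a member of the cover. A point containing
    all their complements would be covered by no member, so these complements are not centered, and
    a finite family of them witnessing this yields the subcover.\<close>
  define C where "C = {A\<in>polars. \<exists>U\<in>\<U>. {y\<in>stone_points. A \<in> y} \<subseteq> U}"
  have "\<not> centered (polar ` C)"
  proof
    assume "centered (polar ` C)"
    then obtain x where x: "x \<in> stone_points" "polar ` C \<subseteq> x" using centered_extends by blast
    then obtain U where U: "U \<in> \<U>" "x \<in> U" using cov by (auto simp: topspace_stone_space)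
    then have "openin stone_space U" using op by blast
    then obtain A where A: "A \<in> x" "{y\<in>stone_points. A \<in> y} \<subseteq> U"
      using U(2) unfolding openin_stone_space by blast
    then have "A \<in> C" using U x stone_point_polars by (auto simp: C_def)
    then have "polar A \<in> x" using x(2) by blast
    then show False using stone_point_polar_iff[OF x(1)] stone_point_polars[OF x(1) A(1)] A(1) by simp
  qed
  then obtain Y where Y: "finite Y" "Y \<subseteq> polar ` C" "\<Inter>Y = {0}"
    unfolding centered_def using polar_in_polars by (smt (verit) imageE subsetI)
  then obtain D where D: "finite D" "D \<subseteq> C" "Y = polar ` D" by (meson finite_subset_image)
  have "\<forall>A\<in>D. \<exists>U\<in>\<U>. {y\<in>stone_points. A \<in> y} \<subseteq> U" using D by (auto simp: C_def)
  then obtain W where W: "\<And>A. A \<in> D \<Longrightarrow> W A \<in> \<U> \<and> {y\<in>stone_points. A \<in> y} \<subseteq> W A" by metis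
  have "topspace stone_space \<subseteq> \<Union>(W ` D)"
  proof
    fix x :: "'a set set" assume "x \<in> topspace stone_space"
    then have x: "x \<in> stone_points" by (simp add: topspace_stone_space)
    have "\<not> Y \<subseteq> x" using stone_point_Inter[OF x Y(1)] Y(3) by metis
    then obtain A where A: "A \<in> D" "polar A \<notin> x" using D by blast
    then have "A \<in> x" using stone_point_polar_iff[OF x] D by (auto simp: C_def)
    then show "x \<in> \<Union>(W ` D)" using W[OF A(1)] A(1) x by blast
  qed
  then show "\<exists>\<F>. finite \<F> \<and> \<F> \<subseteq> \<U> \<and> topspace stone_space \<subseteq> \<Union>\<F>"
    using D W by (intro exI[of _ "W ` D"]) auto
qed

lemma extremally_disconnected_stone_space:
  "extremally_disconnected (stone_space :: 'a::lattice_ab_group_add_abs set set topology)"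
  unfolding extremally_disconnected_def
proof (intro allI impI)
  fix U :: "'a set set set" assume U: "openin stone_space U"
  define C where "C = {A\<in>polars. {y\<in>stone_points. A \<in> y} \<subseteq> U}"
  \<comment> \<open>\<open>polar D\<close> is the supremum, in the complete algebra, of the bands
    whose basic sets lie in \<open>U\<close>. Its basic set turns out to be the closure of
    \<open>U\<close>, and basic sets are open.\<close>
  define D where "D = polar (\<Union>C)"
  have "stone_space closure_of U = {x\<in>stone_points. polar D \<in> x}"
  proof (intro set_eqI iffI)
    fix x assume x: "x \<in> stone_space closure_of U"
    then have xs: "x \<in> stone_points" by (metis in_closure_of topspace_stone_space)
    have "D \<notin> x"
    proof
      assume "D \<in> x"
      then have "x \<in> {y\<in>stone_points. D \<in> y}" using xs by simp
      have "\<exists>y. y \<in> U \<and> y \<in> T" if "x \<in> T" "openin stone_space T" for T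
        using conjunct2[OF x[unfolded in_closure_of]] that by metis
      from this[OF \<open>x \<in> {y\<in>stone_points. D \<in> y}\<close> openin_stone_space_basic]
      have "\<exists>y. y \<in> U \<and> y \<in> {y\<in>stone_points. D \<in> y}" .
      then obtain y where y: "y \<in> U" "D \<in> y" "y \<in> stone_points" by (elim exE conjE CollectE)
      then obtain A where A: "A \<in> y" "{y\<in>stone_points. A \<in> y} \<subseteq> U"
        using U by (auto simp: openin_stone_space)
      then have "A \<in> C" using stone_point_polars[OF y(3)] by (auto simp: C_def)
      then have "D \<subseteq> polar A" unfolding D_def by (intro polar_antimono) auto
      then have "polar A \<in> y" using stone_point_mono[OF y(3) y(2)] by simp
      then show False using stone_point_polar_iff[OF y(3)] A(1) stone_point_polars[OF y(3)] by simp
    qed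
    then show "x \<in> {x\<in>stone_points. polar D \<in> x}"
      using xs stone_point_polar_iff[OF xs, of D] by (auto simp: D_def)
  next
    fix x assume "x \<in> {x\<in>stone_points. polar D \<in> x}"
    then have x: "x \<in> stone_points" "D \<notin> x" using stone_point_polar_iff[of x D] by (auto simp: D_def)
    show "x \<in> stone_space closure_of U" unfolding in_closure_of topspace_stone_space
    proof (intro conjI allI impI)
      fix V assume V: "x \<in> V \<and> openin stone_space V"
      then obtain A where A: "A \<in> x" "{y\<in>stone_points. A \<in> y} \<subseteq> V"
        by (auto simp: openin_stone_space)
      have Ap: "A \<in> polars" using stone_point_polars A x by blast
      show "\<exists>y. y \<in> U \<and> y \<in> V"
      proof (rule ccontr)
        assume no: "\<nexists>y. y \<in> U \<and> y \<in> V"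
        have "A \<subseteq> polar B" if "B \<in> C" for B
        proof (rule disjoint_subset_polar[OF Ap])
          show B: "B \<in> polars" using that by (simp add: C_def)
          show "A \<inter> B \<subseteq> {0}"
          proof (rule ccontr)
            assume "\<not> A \<inter> B \<subseteq> {0}"
            then obtain y where y: "y \<in> stone_points" "A \<inter> B \<in> y"
              using polar_extends[OF polars_Int[OF Ap B]] by auto
            then have "A \<in> y" "B \<in> y" using stone_point_mono[OF y] Ap B by auto
            then show False using y A that no by (auto simp: C_def)
          qed
        qed
        then have "A \<subseteq> D" by (fastforce simp: D_def polar_def)
        then have "D \<in> x" using stone_point_mono[OF x(1) A(1)] by (auto simp: D_def)
        then show False using x by blast
      qed
    qed fact
  qed
  then show "openin stone_space (stone_space closure_of U)"
    using openin_stone_space_basic by metis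
qed

section \<open>Spaces of continuous functions\<close>

lemma sup_norm_empty: "topspace K = {} \<Longrightarrow> sup_norm K g = 0"
  by (simp add: sup_norm_def)

lemma CK_bdd_above:
  assumes "compact_space K" "g \<in> CK K"
  shows "bdd_above ((\<lambda>x. \<bar>g x\<bar>) ` topspace K)"
proof -
  have "compactin euclideanreal (g ` topspace K)"
    using assms unfolding CK_def compact_space_def by (blast intro: image_compactin)
  then have "bounded (g ` topspace K)" by (simp add: compact_imp_bounded)
  then show ?thesis unfolding bounded_iff bdd_above_def by auto
qed

text \<open>Stated for every \<open>x\<close> of the type: representatives vanish off the space, so
  later norm bounds need no membership condition.\<close>

lemma abs_le_sup_norm:
  assumes "compact_space K" "g \<in> CK K"
  shows "\<bar>g x\<bar> \<le> sup_norm K g"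
proof -
  have *: "\<bar>g y\<bar> \<le> sup_norm K g" if "y \<in> topspace K" for y
    using that cSUP_upper[OF that CK_bdd_above[OF assms]] by (auto simp: sup_norm_def)
  have "0 \<le> sup_norm K g"
  proof (cases "topspace K = {}")
    case False
    then obtain y where "y \<in> topspace K" by blast
    then show ?thesis using *[of y] by linarith
  qed (simp add: sup_norm_empty)
  then show ?thesis using * assms(2) by (cases "x \<in> topspace K") (auto simp: CK_def)
qed

lemma sup_norm_nonneg: "compact_space K \<Longrightarrow> g \<in> CK K \<Longrightarrow> 0 \<le> sup_norm K g"
  using abs_le_sup_norm by fastforce

lemma sup_norm_le_iff:
  assumes "compact_space K" "g \<in> CK K" "0 \<le> c"
  shows "sup_norm K g \<le> c \<longleftrightarrow> (\<forall>x. \<bar>g x\<bar> \<le> c)"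
proof
  show "\<forall>x. \<bar>g x\<bar> \<le> c" if "sup_norm K g \<le> c"
    using abs_le_sup_norm[OF assms(1,2)] that by (meson order_trans)
  show "sup_norm K g \<le> c" if "\<forall>x. \<bar>g x\<bar> \<le> c"
    using that assms(3) by (auto simp: sup_norm_def intro: cSUP_least)
qed

lemma const_in_CK: "(\<lambda>x. if x \<in> topspace K then c else 0) \<in> CK K"
proof -
  have "continuous_map K euclideanreal (\<lambda>x. if x \<in> topspace K then c else 0)"
    by (rule continuous_map_eq[of _ _ "\<lambda>x. c"]) auto
  then show ?thesis by (simp add: CK_def)
qed

lemma CK_diff: "g \<in> CK K \<Longrightarrow> h \<in> CK K \<Longrightarrow> g - h \<in> CK K"
  by (auto simp: CK_def fun_diff_def intro: continuous_map_diff)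

lemma CK_sup_0: "g \<in> CK K \<Longrightarrow> sup g 0 \<in> CK K"
  by (auto simp: CK_def sup_fun_def zero_fun_def sup_max intro: continuous_map_real_max)

section \<open>Embeddings with regular range\<close>

text \<open>If a lower bound \<open>g\<close> of \<open>P\<close> in \<open>G\<close> were not below
  \<open>0\<close>, density would give \<open>0 < e \<le> sup g 0\<close> with \<open>e\<close> in
  \<open>E\<close>. As all members of \<open>P\<close> are nonnegative, \<open>e\<close> would bound
  \<open>P\<close> below, against infimum \<open>0\<close> in \<open>E\<close>.\<close>

lemma order_dense_imp_regular:
  fixes E G :: "'b::vector_lattice set"
  assumes E: "order_dense_sublattice E G" and G: "\<And>g. g \<in> G \<Longrightarrow> sup g 0 \<in> G"
  shows "regular_sublattice E G"
  unfolding regular_sublattice_def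
proof (intro conjI allI impI)
  show sub: "sublattice E G" using E by (simp add: order_dense_sublattice_def)
  fix P assume P: "P \<noteq> {} \<and> P \<subseteq> E \<and> isGlb E P 0"
  have P0: "0 \<le> p" if "p \<in> P" for p using P that by (meson isGlbD2)
  have "g \<le> 0" if g: "g \<in> G" "\<And>p. p \<in> P \<Longrightarrow> g \<le> p" for g
  proof (rule ccontr)
    assume "\<not> g \<le> 0"
    then have "0 < sup g 0" by (metis le_iff_sup less_le sup_ge2)
    then obtain e where e: "e \<in> E" "0 < e" "e \<le> sup g 0"
      using E G[OF g(1)] unfolding order_dense_sublattice_def by meson
    have "e \<le> p" if "p \<in> P" for p
      using e(3) le_supI[OF g(2)[OF that] P0[OF that]] by (rule order_trans)
    then have "isLb E P e" using e(1) by (auto simp: isLb_def setge_def)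
    then have "e \<le> 0" using P by (meson isGlb_le_isLb)
    then show False using e(2) by (meson leD)
  qed
  moreover have "0 \<in> G" using sub unfolding sublattice_def by (meson subset_iff subspace_0)
  ultimately show "isGlb G P 0"
    using P0 by (auto simp: isGlb_def greatestP_def isLb_def setge_def setle_def)
qed

section \<open>Lattice homomorphisms and embeddings\<close>

lemma lattice_hom_linear: "lattice_hom T \<Longrightarrow> linear T"
  and lattice_hom_sup: "lattice_hom T \<Longrightarrow> T (sup f g) = sup (T f) (T g)"
  by (simp_all add: lattice_hom_def)

lemma lattice_hom_mono: "lattice_hom T \<Longrightarrow> f \<le> g \<Longrightarrow> T f \<le> T g"
  by (metis lattice_hom_sup le_iff_sup)

lemma embedding_in_CK: "embedding K T \<Longrightarrow> T f \<in> CK K"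
  by (auto simp: embedding_def)

lemma embedding_hom: "embedding K T \<Longrightarrow> lattice_hom T"
  by (simp add: embedding_def)

lemma embedding_le_iff: "embedding K T \<Longrightarrow> T f \<le> T g \<longleftrightarrow> f \<le> g"
  by (simp add: embedding_def le_iff_sup lattice_hom_sup[symmetric] inj_eq)

lemma lattice_hom_abs:
  fixes T :: "'a::{vector_lattice,lattice_ab_group_add_abs} \<Rightarrow> 'k \<Rightarrow> real"
  assumes "lattice_hom T"
  shows "T \<bar>f\<bar> x = \<bar>T f x\<bar>"
proof -
  have "T \<bar>f\<bar> = sup (T f) (- T f)"
    using lattice_hom_sup[OF assms] linear_neg[OF lattice_hom_linear[OF assms]] by (simp add: abs_lattice)
  then show ?thesis by (simp add: sup_max abs_real_def)
qed

section \<open>Directed suprema under regular embeddings\<close>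

lemma directed_up_to_Lub:
  assumes "P \<up> f"
  shows "P \<noteq> {}" "p \<in> P \<Longrightarrow> p \<le> f" "(\<And>p. p \<in> P \<Longrightarrow> p \<le> u) \<Longrightarrow> f \<le> u"
  using assms by (auto simp: directed_up_to_def isLub_def leastP_def isUb_def setle_def setge_def)

text \<open>Pointwise demicontinuity quantifies over all real \<open>s\<close>. For
  \<open>s \<le> 0\<close> the scaled positive ball has only nonpositive elements, which cannot have
  a positive supremum.\<close>

lemma scale_pos_if_directed_up_to:
  assumes P: "P \<subseteq> (*\<^sub>R) s ` pos_ball N" "P \<up> f" and f: "0 < f"
  shows "0 < s"
proof (rule ccontr)
  assume "\<not> 0 < s"
  then have s: "s \<le> 0" by simp
  have "p \<le> 0" if p: "p \<in> P" for p
  proof -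
    obtain b where "p = s *\<^sub>R b" "0 \<le> b" using subsetD[OF P(1) p] by (auto simp: pos_ball_def)
    then show ?thesis using s by (simp add: scaleR_nonpos_nonneg)
  qed
  then have "f \<le> 0" by (rule directed_up_to_Lub(3)[OF P(2)])
  then show False using f by (meson leD)
qed

text \<open>The constant function \<open>c\<close> on \<open>K\<close> is an upper bound of the image of \<open>P\<close>, and regularity makes
  the image of the supremum a supremum in $C(K)$.\<close>

lemma regular_sup_norm_bound:
  assumes K: "compact_space K" and T: "embedding K T"
    and reg: "regular_sublattice (range T) (CK K)"
    and P: "P \<up> f" "\<And>p. p \<in> P \<Longrightarrow> 0 \<le> p" "\<And>p. p \<in> P \<Longrightarrow> sup_norm K (T p) \<le> c"
  shows "sup_norm K (T f) \<le> c"
proof -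
  note lin = lattice_hom_linear[OF embedding_hom[OF T]]
  obtain p0 where p0: "p0 \<in> P" using directed_up_to_Lub(1)[OF P(1)] by (meson ex_in_conv)
  have c: "0 \<le> c" using P(3)[OF p0] sup_norm_nonneg[OF K embedding_in_CK[OF T]] by (meson order_trans)
  \<comment> \<open>Regularity speaks of sets with infimum \<open>0\<close> only, so the supremum
    \<open>f\<close> of \<open>P\<close> is turned into the infimum \<open>0\<close> of the
    differences.\<close>
  let ?Q = "(\<lambda>p. T f - T p) ` P"
  have diff: "T f - T p = T (f - p)" for p by (simp add: linear_diff[OF lin])
  have T0: "T 0 = 0" by (rule linear_0[OF lin])
  have "isGlb (range T) ?Q 0"
    unfolding isGlb_def greatestP_def isLb_def setge_def setle_def mem_Collect_eq
  proof (intro conjI ballI allI impI)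
    show "0 \<in> range T" using T0 by (metis rangeI)
    fix q assume "q \<in> ?Q"
    then obtain p where p: "p \<in> P" "q = T (f - p)" using diff by blast
    have "T 0 \<le> T (f - p)"
      using directed_up_to_Lub(2)[OF P(1) p(1)] by (intro lattice_hom_mono[OF embedding_hom[OF T]]) simp
    then show "0 \<le> q" using p T0 by simp
  next
    fix g assume "g \<in> {g. (\<forall>q\<in>?Q. g \<le> q) \<and> g \<in> range T}"
    then have g: "(\<forall>q\<in>?Q. g \<le> q) \<and> g \<in> range T" by simp
    then obtain h where h: "g = T h" by blast
    have "p \<le> f - h" if "p \<in> P" for p
    proof -
      have "T h \<le> T (f - p)" using g that h diff by auto
      then have "h \<le> f - p" by (simp add: embedding_le_iff[OF T])
      then show ?thesis by (simp add: le_diff_eq add.commute)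
    qed
    then have "f \<le> f - h" by (rule directed_up_to_Lub(3)[OF P(1)])
    then have "h \<le> 0" by simp
    then show "g \<le> 0" using lattice_hom_mono[OF embedding_hom[OF T]] h T0 by metis
  qed
  moreover have "?Q \<noteq> {}" using p0 by blast
  moreover have "?Q \<subseteq> range T" using diff by auto
  ultimately have glb: "isGlb (CK K) ?Q 0" using reg unfolding regular_sublattice_def by meson
  let ?g = "T f - (\<lambda>x. if x \<in> topspace K then c else 0)"
  have "isLb (CK K) ?Q ?g" unfolding isLb_def setge_def
  proof (intro conjI ballI)
    show "?g \<in> CK K" by (intro CK_diff const_in_CK embedding_in_CK[OF T])
    fix q assume "q \<in> ?Q"
    then obtain p where p: "p \<in> P" "q = T f - T p" by blast
    have "\<bar>T p x\<bar> \<le> c" for x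
      using P(3)[OF p(1)] sup_norm_le_iff[OF K embedding_in_CK[OF T] c] by blast
    moreover have "T p x = 0" if "x \<notin> topspace K" for x
      using embedding_in_CK[OF T, of p] that by (simp add: CK_def)
    ultimately show "?g \<le> q" unfolding p(2) le_fun_def by (auto simp: abs_le_iff)
  qed
  then have "?g \<le> 0" using glb by (meson isGlb_le_isLb)
  then have le: "T f x \<le> c" for x
    using c embedding_in_CK[OF T, of f] by (cases "x \<in> topspace K") (auto simp: le_fun_def CK_def split: if_splits)
  have "0 \<le> f" using P(2)[OF p0] directed_up_to_Lub(2)[OF P(1) p0] by (rule order_trans)
  then have "0 \<le> T f" using lattice_hom_mono[OF embedding_hom[OF T]] T0 by metis
  then have "\<bar>T f x\<bar> \<le> c" for x using le[of x] by (simp add: le_fun_def)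
  then show ?thesis using sup_norm_le_iff[OF K embedding_in_CK[OF T] c] by blast
qed

text \<open>Images of the unit ball have sup norm at most \<open>b\<close>, suprema inherit this
  bound, and passing back to \<open>N\<close> costs the factor \<open>1 / a\<close>. The functional
  \<open>N\<close> is left general so that the lemma also applies to a renorming.\<close>

lemma r_demicontinuous_if_regular:
  assumes K: "compact_space K" and T: "embedding K T"
    and reg: "regular_sublattice (range T) (CK K)" and ab: "0 < a" "0 < b"
    and N: "\<And>f. a * N f \<le> sup_norm K (T f)" "\<And>f. sup_norm K (T f) \<le> b * N f"
  shows "r_demicontinuous (b / a) N"
  unfolding r_demicontinuous_def
proof (intro allI impI)
  fix P f assume P: "P \<subseteq> pos_ball N \<and> P \<up> f"
  have "sup_norm K (T f) \<le> b"
  proof (rule regular_sup_norm_bound[OF K T reg])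
    fix p assume "p \<in> P"
    then have p: "N p \<le> 1" "0 \<le> p" using P by (auto simp: pos_ball_def)
    have "b * N p \<le> b * 1" using ab p by (intro mult_left_mono) auto
    then show "sup_norm K (T p) \<le> b" using N(2)[of p] by linarith
    show "0 \<le> p" by fact
  qed (use P in simp)
  then have "a * N f \<le> b" using N(1)[of f] by linarith
  then show "N f \<le> b / a" using ab by (simp add: field_simps)
qed

subsection \<open>Automatic boundedness\<close>

lemma norm_abs_eq [simp]:
  fixes x :: "'a::am_space"
  shows "norm \<bar>x\<bar> = norm x"
  by (rule antisym) (auto intro: norm_solid)

lemma norm_pprt_le:
  fixes x :: "'a::am_space"
  shows "norm (pprt x) \<le> norm x"
proof (rule norm_solid)
  show "\<bar>pprt x\<bar> \<le> \<bar>x\<bar>" by (simp add: pprt_def abs_ge_self)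
qed

lemma norm_mono_nonneg:
  fixes x y :: "'a::am_space"
  assumes "0 \<le> x" "x \<le> y"
  shows "norm x \<le> norm y"
  using assms by (intro norm_solid) (simp add: order_trans[OF assms])

text \<open>Closedness of the positive cone: the positive part of \<open>- L\<close> is dominated by
  that of \<open>X n - L\<close>, whose norm tends to \<open>0\<close>.\<close>

lemma LIMSEQ_nonneg:
  fixes X :: "nat \<Rightarrow> 'a::am_space"
  assumes X: "X \<longlonglongrightarrow> L" "\<And>n. N \<le> n \<Longrightarrow> 0 \<le> X n"
  shows "0 \<le> L"
proof -
  have "norm (pprt (- L)) \<le> norm (X n - L)" if "N \<le> n" for n
  proof -
    have "pprt (- L) \<le> pprt (X n - L)" using X(2)[OF that] by (intro pprt_mono) simp
    then have "norm (pprt (- L)) \<le> norm (pprt (X n - L))" by (intro norm_mono_nonneg) simp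
    then show ?thesis using norm_pprt_le[of "X n - L"] by linarith
  qed
  moreover have "(\<lambda>n. norm (X n - L)) \<longlonglongrightarrow> 0"
    using X(1) by (simp add: LIM_zero tendsto_norm_zero)
  ultimately have "norm (pprt (- L)) \<le> 0"
    by (intro Lim_bounded2[of "\<lambda>n. norm (X n - L)" 0 N]) auto
  then have "pprt (- L) = 0" by simp
  then have "- L \<le> 0" by (simp only: le_zero_iff_zero_pprt)
  then show ?thesis by simp
qed

lemma le_suminf:
  fixes g :: "nat \<Rightarrow> 'a::am_space"
  assumes "summable g" "\<And>n. 0 \<le> g n"
  shows "g k \<le> suminf g"
proof -
  have "(\<lambda>n. sum g {..<n} - g k) \<longlonglongrightarrow> suminf g - g k"
    using assms(1) by (intro tendsto_diff tendsto_const) (simp add: summable_LIMSEQ)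
  moreover have "0 \<le> sum g {..<n} - g k" if "Suc k \<le> n" for n
  proof -
    have "sum g {..<n} = g k + sum g ({..<n} - {k})" using that by (subst sum.remove[of _ k]) auto
    moreover have "0 \<le> sum g ({..<n} - {k})" by (intro sum_nonneg assms)
    ultimately show ?thesis by simp
  qed
  ultimately have "0 \<le> suminf g - g k" by (rule LIMSEQ_nonneg)
  then show ?thesis by simp
qed

text \<open>The classical fact that positive operators on a Banach lattice are bounded: were
  \<open>T\<close> unbounded, a convergent series of positive elements would have a sum whose image
  is an unbounded function.\<close>

lemma embedding_bounded:
  fixes T :: "'a::am_space \<Rightarrow> 'k \<Rightarrow> real"
  assumes K: "compact_space K" and T: "embedding K T"
  shows "\<exists>C>0. \<forall>f. sup_norm K (T f) \<le> C * norm f"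
proof (rule ccontr)
  assume no: "\<not> ?thesis"
  note hom = embedding_hom[OF T]
  note lin = lattice_hom_linear[OF hom]
  have "\<exists>f x. 4 ^ n * norm f < \<bar>T f x\<bar>" for n :: nat
  proof -
    obtain f where "\<not> sup_norm K (T f) \<le> 4 ^ n * norm f" using no by (metis zero_less_power zero_less_numeral)
    then show ?thesis
      using sup_norm_le_iff[OF K embedding_in_CK[OF T, of f], of "4 ^ n * norm f"] by (force simp: not_le)
  qed
  then obtain f x where fx: "\<And>n::nat. 4 ^ n * norm (f n) < \<bar>T (f n) (x n)\<bar>" by metis
  have fn: "0 < norm (f n)" for n
  proof -
    have "f n \<noteq> 0" using fx[of n] linear_0[OF lin] by auto
    then show ?thesis by simp
  qed
  \<comment> \<open>The factor \<open>4 ^ n\<close> is shared out: dividing by \<open>2 ^ n\<close>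
    makes the norms summable, and the remaining \<open>2 ^ n\<close> still bounds the image of
    \<open>g n\<close> at \<open>x n\<close> from below.\<close>
  define g where "g n = (1 / (2 ^ n * norm (f n))) *\<^sub>R \<bar>f n\<bar>" for n
  have ng: "norm (g n) = (1 / 2) ^ n" for n
    using fn[of n] by (simp add: g_def power_divide)
  have "summable g"
  proof (rule summable_norm_cancel)
    show "summable (\<lambda>n. norm (g n))" by (simp add: ng summable_geometric)
  qed
  moreover have "0 \<le> g n" for n by (simp add: g_def scaleR_nonneg_nonneg)
  ultimately have le: "g n \<le> suminf g" for n by (rule le_suminf)
  have "2 ^ n < sup_norm K (T (suminf g))" for n
  proof -
    have "T (g n) (x n) = \<bar>T (f n) (x n)\<bar> / (2 ^ n * norm (f n))"
      by (simp add: g_def linear_scale[OF lin] scaleR_fun_def lattice_hom_abs[OF hom])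
    moreover have "2 ^ n < \<bar>T (f n) (x n)\<bar> / (2 ^ n * norm (f n))"
    proof -
      have "(2::real) ^ n * (2 ^ n * norm (f n)) = 4 ^ n * norm (f n)"
        by (simp add: power_mult_distrib[symmetric])
      then have "2 ^ n * (2 ^ n * norm (f n)) < \<bar>T (f n) (x n)\<bar>" using fx[of n] by (simp only:)
      moreover have "0 < 2 ^ n * norm (f n)" using fn[of n] by simp
      ultimately show ?thesis by (simp only: pos_less_divide_eq)
    qed
    moreover have "T (g n) (x n) \<le> T (suminf g) (x n)"
      using lattice_hom_mono[OF hom le[of n]] by (simp add: le_fun_def)
    moreover have "\<bar>T (suminf g) (x n)\<bar> \<le> sup_norm K (T (suminf g))"
      by (rule abs_le_sup_norm[OF K embedding_in_CK[OF T]])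
    ultimately show ?thesis by linarith
  qed
  moreover obtain n where "sup_norm K (T (suminf g)) < 2 ^ n"
    using real_arch_pow[of 2] by auto
  ultimately show False by (meson less_asym)
qed

text \<open>With \<open>C\<close> the automatic bound of \<open>T\<close>, a family in
  \<open>s\<close> times the ball has images of sup norm at most \<open>C * s\<close>. Its supremum
  \<open>f\<close> inherits this, so \<open>t = sup_norm K (T f) / C\<close> works; it is positive
  by injectivity.\<close>

lemma pointwise_demicontinuous_if_regular:
  fixes T :: "'a::am_space \<Rightarrow> 'k \<Rightarrow> real"
  assumes K: "compact_space K" and T: "embedding K T"
    and reg: "regular_sublattice (range T) (CK K)"
  shows "pointwise_demicontinuous (norm :: 'a \<Rightarrow> real)"
  unfolding pointwise_demicontinuous_def
proof (intro allI impI)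
  fix f :: 'a assume f: "0 < f"
  obtain C where C: "0 < C" "\<And>f. sup_norm K (T f) \<le> C * norm f" using embedding_bounded[OF K T] by blast
  have "T f \<noteq> T 0" using f T by (auto simp: embedding_def dest: injD)
  then have "T f \<noteq> (\<lambda>x. 0)"
    using linear_0[OF lattice_hom_linear[OF embedding_hom[OF T]]] by (simp add: zero_fun_def)
  then obtain x where "T f x \<noteq> 0" by blast
  then have pos: "0 < sup_norm K (T f)"
    using abs_le_sup_norm[OF K embedding_in_CK[OF T], of f x] by linarith
  show "\<exists>t>0. \<forall>P s. P \<subseteq> (*\<^sub>R) s ` pos_ball norm \<and> P \<up> f \<longrightarrow> t \<le> s"
  proof (intro exI[of _ "sup_norm K (T f) / C"] conjI allI impI)
    show "0 < sup_norm K (T f) / C" using pos C by simp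
    fix P s assume P: "P \<subseteq> (*\<^sub>R) s ` pos_ball norm \<and> P \<up> f"
    have b: "\<exists>b. p = s *\<^sub>R b \<and> norm b \<le> 1 \<and> 0 \<le> b" if "p \<in> P" for p
      using P that by (auto simp: pos_ball_def)
    have s: "0 < s" using P f by (intro scale_pos_if_directed_up_to[of P s norm f]) auto
    have "sup_norm K (T f) \<le> C * s"
    proof (rule regular_sup_norm_bound[OF K T reg])
      fix p assume "p \<in> P"
      then obtain b where b: "p = s *\<^sub>R b" "norm b \<le> 1" "0 \<le> b" using b by blast
      show "0 \<le> p" using b s by (simp add: scaleR_nonneg_nonneg)
      have "norm p \<le> s" using b s by simp
      then have "C * norm p \<le> C * s" using C by (intro mult_left_mono) auto
      then show "sup_norm K (T p) \<le> C * s" using C(2)[of p] by linarith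
    qed (use P in simp)
    then show "sup_norm K (T f) / C \<le> s" using C by (simp add: field_simps)
  qed
qed

section \<open>Level bands\<close>

lemma scaleR_pprt:
  fixes f :: "'a::{vector_lattice,lattice_ab_group_add_abs}"
  assumes "0 < c"
  shows "pprt (c *\<^sub>R f) = c *\<^sub>R pprt f"
proof (rule antisym)
  have le: "pprt (c *\<^sub>R f) \<le> c *\<^sub>R pprt f" if "0 < c" for c and f :: 'a
    unfolding pprt_def using that
    by (intro le_supI scaleR_left_mono) (simp_all add: scaleR_nonneg_nonneg)
  show "pprt (c *\<^sub>R f) \<le> c *\<^sub>R pprt f" using le assms .
  have "pprt (inverse c *\<^sub>R (c *\<^sub>R f)) \<le> inverse c *\<^sub>R pprt (c *\<^sub>R f)"
    using assms by (intro le) simp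
  then have "c *\<^sub>R pprt f \<le> c *\<^sub>R (inverse c *\<^sub>R pprt (c *\<^sub>R f))"
    using assms by (intro scaleR_left_mono) simp_all
  then show "c *\<^sub>R pprt f \<le> pprt (c *\<^sub>R f)" using assms by simp
qed

lemma inf_scaleR_0:
  fixes u v :: "'a::{vector_lattice,lattice_ab_group_add_abs}"
  assumes "0 \<le> u" "0 \<le> v" "inf u v = 0" "0 < c"
  shows "inf u (c *\<^sub>R v) = 0"
proof (rule antisym)
  \<comment> \<open>Both \<open>c\<close> and \<open>1\<close> are at most \<open>d\<close>, so
    dividing \<open>?m\<close> by \<open>d\<close> brings it below \<open>u\<close> and
    \<open>v\<close> simultaneously.\<close>
  define d where "d = max c 1"
  have d: "0 < d" "c \<le> d" "1 \<le> d" by (auto simp: d_def)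
  let ?m = "inf u (c *\<^sub>R v)"
  have m: "0 \<le> ?m" using assms by (simp add: scaleR_nonneg_nonneg)
  have "inverse d *\<^sub>R ?m \<le> 1 *\<^sub>R ?m"
    using d m by (intro scaleR_right_mono) (auto simp: field_simps)
  then have 1: "inverse d *\<^sub>R ?m \<le> u" by (simp add: le_infE)
  have "?m \<le> d *\<^sub>R v"
    using scaleR_right_mono[OF d(2) assms(2)] by (simp add: le_infI2)
  then have "inverse d *\<^sub>R ?m \<le> inverse d *\<^sub>R (d *\<^sub>R v)"
    using d by (intro scaleR_left_mono) simp_all
  then have 2: "inverse d *\<^sub>R ?m \<le> v" using d by simp
  have "inverse d *\<^sub>R ?m \<le> inf u v" using 1 2 by (rule le_infI)
  then have "d *\<^sub>R (inverse d *\<^sub>R ?m) \<le> d *\<^sub>R 0"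
    using d assms(3) by (intro scaleR_left_mono) simp_all
  then show "?m \<le> 0" using d by simp
  show "0 \<le> ?m" by (rule m)
qed

lemma inf_add_eq_0:
  fixes k u v w :: "'a::lattice_ab_group_add"
  assumes "0 \<le> k" "0 \<le> u" "0 \<le> v" "inf k u = 0" "inf k v = 0" "0 \<le> w" "w \<le> u + v"
  shows "inf k w = 0"
proof (rule inf_mono_0[of k "u + v"])
  have "inf (u + v) k \<le> inf u k + inf v k" by (intro inf_add_le assms)
  also have "\<dots> = 0" using assms(4,5) by (simp add: inf_commute)
  finally show "inf k (u + v) = 0"
    using assms(1-3) by (intro antisym) (simp_all add: inf_commute)
qed (use assms in auto)

lemma pprt_minus_pprt: "f = pprt f - pprt (- f :: 'a::lattice_ab_group_add)"
  using prts[of f] pprt_neg[of f] by simp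

lemma inf_pprt_pprt_uminus:
  fixes h :: "'a::lattice_ab_group_add"
  shows "inf (pprt h) (pprt (- h)) = 0"
proof -
  have "pprt h = h - inf h 0" "pprt (- h) = 0 - inf h 0"
    by (simp_all add: pprt_def diff_inf_eq_sup neg_inf_eq_sup add_sup_distrib_left sup_commute)
  then show ?thesis by (metis add_inf_distrib_right diff_conv_add_uminus diff_self)
qed

text \<open>Where \<open>u\<close> and \<open>v\<close> are both positive, \<open>u + v\<close> is
  the sum of their positive parts. Formally, \<open>h\<close> is disjoint from both negative parts,
  hence from their sum \<open>?z\<close>; it lies below \<open>pprt (u + v) + ?z\<close>, and
  \<open>?z\<close> contributes nothing.\<close>

lemma le_pprt_add_if_le_pprt:
  fixes u v :: "'a::lattice_ab_group_add"
  assumes "0 \<le> h" "h \<le> pprt u" "h \<le> pprt v"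
  shows "h \<le> pprt (u + v)"
proof -
  let ?z = "pprt (- u) + pprt (- v)"
  have "inf h (pprt (- u)) = 0" "inf h (pprt (- v)) = 0"
    using assms by (simp_all add: inf_mono_0[OF inf_pprt_pprt_uminus])
  then have z: "inf h ?z = 0" using assms by - (rule inf_add_eq_0[of h "pprt (- u)" "pprt (- v)"], simp_all)
  have "h \<le> h + h" using assms by simp
  also have "\<dots> \<le> pprt u + pprt v" using assms by (intro add_mono)
  also have "\<dots> = u + v + ?z"
  proof -
    have "pprt u = u + pprt (- u)" "pprt v = v + pprt (- v)"
      using pprt_minus_pprt[of u] pprt_minus_pprt[of v] by (metis eq_diff_eq)+
    then show ?thesis by (simp only: add_ac)
  qed
  also have "\<dots> \<le> pprt (u + v) + ?z" by (intro add_right_mono) (simp add: pprt_def)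
  finally have "h \<le> inf (pprt (u + v) + ?z) h" by simp
  also have "\<dots> \<le> inf (pprt (u + v)) h + inf ?z h" using assms by (intro inf_add_le) simp_all
  also have "\<dots> = inf (pprt (u + v)) h" using z by (simp add: inf_commute)
  finally show ?thesis by simp
qed

text \<open>The AM-property at work: the positive part of the ball is upward directed, so two of its
  elements can be replaced by a common one.\<close>

lemma pos_ball_sup:
  fixes b c :: "'a::am_space"
  shows "b \<in> pos_ball norm \<Longrightarrow> c \<in> pos_ball norm \<Longrightarrow> sup b c \<in> pos_ball norm"
  by (simp add: pos_ball_def norm_sup le_supI1)

text \<open>Includes \<open>f = 0\<close>, where division by the zero norm returns
  \<open>0\<close>.\<close>

lemma normalize_in_pos_ball:
  fixes f :: "'a::am_space"
  shows "0 \<le> f \<Longrightarrow> f /\<^sub>R norm f \<in> pos_ball norm"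
  by (cases "f = 0") (simp_all add: pos_ball_def scaleR_nonneg_nonneg)

text \<open>With \<open>e\<close> the (ideal) supremum of the positive part of the unit ball, \<open>level f l\<close> is
  the band on which \<open>f \<ge> l e\<close>.\<close>

definition level :: "'a::am_space \<Rightarrow> real \<Rightarrow> 'a set"
  where "level f l = polar ((\<lambda>b. pprt (l *\<^sub>R b - f)) ` pos_ball norm)"

lemma level_in_polars [simp]: "level f l \<in> polars"
  by (simp add: level_def)

lemma abs_pprt [simp]: "\<bar>pprt f\<bar> = pprt (f :: 'a::lattice_ab_group_add_abs)"
  by (simp add: abs_of_nonneg)

lemma level_iff: "k \<in> level f l \<longleftrightarrow> (\<forall>b\<in>pos_ball norm. inf \<bar>k\<bar> (pprt (l *\<^sub>R b - f)) = 0)"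
  by (simp add: level_def polar_def)

lemma level_antimono:
  assumes "l \<le> m"
  shows "level f m \<subseteq> level f l"
proof
  fix k assume k: "k \<in> level f m"
  show "k \<in> level f l" unfolding level_iff
  proof
    fix b :: 'a assume b: "b \<in> pos_ball norm"
    then have "l *\<^sub>R b \<le> m *\<^sub>R b" using assms by (intro scaleR_right_mono) (auto simp: pos_ball_def)
    then have "pprt (l *\<^sub>R b - f) \<le> pprt (m *\<^sub>R b - f)" by (intro pprt_mono) simp
    then show "inf \<bar>k\<bar> (pprt (l *\<^sub>R b - f)) = 0"
      using k b by - (rule inf_mono_0[of "\<bar>k\<bar>" "pprt (m *\<^sub>R b - f)"], auto simp: level_iff)
  qed
qed

lemma level_nonpos:
  assumes "0 \<le> f" "l \<le> 0"
  shows "level f l = UNIV"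
proof -
  have "pprt (l *\<^sub>R b - f) = 0" if "b \<in> pos_ball norm" for b
  proof -
    have "l *\<^sub>R b \<le> 0" using assms that by (simp add: pos_ball_def scaleR_nonpos_nonneg)
    then have "l *\<^sub>R b \<le> f" using assms(1) by (rule order_trans)
    then show ?thesis by (intro pprt_eq_0) simp
  qed
  then show ?thesis by (auto simp: level_iff)
qed

lemma level_scaleR:
  assumes "0 < c"
  shows "level f l \<subseteq> level (c *\<^sub>R f) (c * l)"
proof
  fix k assume k: "k \<in> level f l"
  show "k \<in> level (c *\<^sub>R f) (c * l)" unfolding level_iff
  proof
    fix b :: 'a assume "b \<in> pos_ball norm"
    then have "inf \<bar>k\<bar> (c *\<^sub>R pprt (l *\<^sub>R b - f)) = 0"
      using k assms by - (rule inf_scaleR_0, auto simp: level_iff)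
    moreover have "(c * l) *\<^sub>R b - c *\<^sub>R f = c *\<^sub>R (l *\<^sub>R b - f)" by (simp add: scaleR_diff_right)
    ultimately show "inf \<bar>k\<bar> (pprt ((c * l) *\<^sub>R b - c *\<^sub>R f)) = 0" using assms by (simp only: scaleR_pprt)
  qed
qed

lemma le_pprt_add: "f \<le> pprt (f - g) + (g::'a::lattice_ab_group_add)"
  by (metis diff_le_eq pprt_def sup_ge1)

text \<open>On such a band \<open>f\<close> would vanish while dominating \<open>l e\<close>.
  Testing with the normalised \<open>\<bar>k\<bar>\<close> shows that \<open>\<bar>k\<bar>\<close>
  is disjoint both from the positive part of \<open>c *\<^sub>R \<bar>k\<bar> - f\<close> and from
  \<open>f\<close>, hence from a positive multiple of itself.\<close>

lemma level_disjoint: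
  assumes k: "k \<in> level f l" and f: "0 \<le> f" and dis: "inf \<bar>k\<bar> f = 0" and l: "0 < l"
  shows "k = 0"
proof (rule ccontr)
  assume "k \<noteq> 0"
  define c where "c = l / norm \<bar>k\<bar>"
  have c: "0 < c" using \<open>k \<noteq> 0\<close> l by (simp add: c_def)
  have eq: "l *\<^sub>R (\<bar>k\<bar> /\<^sub>R norm \<bar>k\<bar>) = c *\<^sub>R \<bar>k\<bar>" by (simp add: c_def divide_inverse)
  have "inf \<bar>k\<bar> (pprt (l *\<^sub>R (\<bar>k\<bar> /\<^sub>R norm \<bar>k\<bar>) - f)) = 0"
    using k normalize_in_pos_ball[of "\<bar>k\<bar>"] unfolding level_iff by (meson abs_ge_zero)
  then have "inf \<bar>k\<bar> (pprt (c *\<^sub>R \<bar>k\<bar> - f)) = 0" unfolding eq .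
  then have "inf \<bar>k\<bar> (c *\<^sub>R \<bar>k\<bar>) = 0"
    using f dis c le_pprt_add[of "c *\<^sub>R \<bar>k\<bar>" f]
    by - (rule inf_add_eq_0[of "\<bar>k\<bar>" "pprt (c *\<^sub>R \<bar>k\<bar> - f)" f], simp_all add: scaleR_nonneg_nonneg)
  then have "inf \<bar>k\<bar> (inverse c *\<^sub>R (c *\<^sub>R \<bar>k\<bar>)) = 0"
    using c by - (rule inf_scaleR_0, simp_all add: scaleR_nonneg_nonneg)
  then show False using c \<open>k \<noteq> 0\<close> by simp
qed

text \<open>This expresses \<open>f \<le> norm f * e\<close>. For \<open>b\<close> the normalised
  \<open>f\<close>, the difference \<open>l b - f\<close> is a positive multiple of
  \<open>f\<close>; elements of the level are therefore disjoint from \<open>f\<close> and vanish by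
  \<open>level_disjoint\<close>.\<close>

lemma level_above_norm:
  assumes "0 \<le> f" "norm f < l"
  shows "level f l = {0}"
proof -
  have "k = 0" if k: "k \<in> level f l" for k
  proof (rule level_disjoint[OF k assms(1)])
    show l: "0 < l" using assms(2) norm_ge_zero[of f] by linarith
    show "inf \<bar>k\<bar> f = 0"
    proof (cases "f = 0")
      case False
      define c where "c = l / norm f - 1"
      have c: "0 < c" using False assms(2) by (simp add: c_def field_simps)
      have eq: "l *\<^sub>R (f /\<^sub>R norm f) - f = c *\<^sub>R f"
        by (simp add: c_def divide_inverse scaleR_diff_left)
      have "inf \<bar>k\<bar> (pprt (l *\<^sub>R (f /\<^sub>R norm f) - f)) = 0"
        using k normalize_in_pos_ball[OF assms(1)] unfolding level_iff by meson
      then have "inf \<bar>k\<bar> (c *\<^sub>R f) = 0" using c assms(1) unfolding eq by (simp add: scaleR_pprt)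
      then have "inf \<bar>k\<bar> (inverse c *\<^sub>R (c *\<^sub>R f)) = 0"
        using c assms(1) by - (rule inf_scaleR_0, simp_all add: scaleR_nonneg_nonneg)
      then show ?thesis using c by simp
    qed simp
  qed
  then show ?thesis using zero_in_polars[OF level_in_polars[of f l]] by auto
qed

lemma level_add: "level f l \<inter> level g m \<subseteq> level (f + g) (l + m)"
proof
  fix k assume k: "k \<in> level f l \<inter> level g m"
  show "k \<in> level (f + g) (l + m)" unfolding level_iff
  proof
    fix b :: 'a assume b: "b \<in> pos_ball norm"
    let ?u = "l *\<^sub>R b - f" and ?v = "m *\<^sub>R b - g"
    have "?u + ?v \<le> pprt ?u + pprt ?v" by (intro add_mono) (simp_all add: pprt_def)
    then have "pprt (?u + ?v) \<le> pprt ?u + pprt ?v" by (simp add: pprt_def[of "?u + ?v"])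
    then have "inf \<bar>k\<bar> (pprt (?u + ?v)) = 0"
      using k b by - (rule inf_add_eq_0[of "\<bar>k\<bar>" "pprt ?u" "pprt ?v"], auto simp: level_iff)
    moreover have "?u + ?v = (l + m) *\<^sub>R b - (f + g)" by (simp add: scaleR_add_left)
    ultimately show "inf \<bar>k\<bar> (pprt ((l + m) *\<^sub>R b - (f + g))) = 0" by simp
  qed
qed

lemma level_inf: "level f l \<inter> level g l \<subseteq> level (inf f g) l"
proof
  fix k assume k: "k \<in> level f l \<inter> level g l"
  show "k \<in> level (inf f g) l" unfolding level_iff
  proof
    fix b :: 'a assume b: "b \<in> pos_ball norm"
    let ?u = "l *\<^sub>R b - f" and ?v = "l *\<^sub>R b - g"
    have "?u \<le> pprt ?u" "?v \<le> pprt ?v" by (simp_all add: pprt_def)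
    then have "?u \<le> pprt ?u + pprt ?v" "?v \<le> pprt ?u + pprt ?v"
      using add_increasing2[of "pprt ?v" ?u "pprt ?u"] add_increasing[of "pprt ?u" ?v "pprt ?v"] by simp_all
    moreover have "l *\<^sub>R b - inf f g = sup ?u ?v"
      by (subst diff_inf_eq_sup) (simp only: add_sup_distrib_left diff_conv_add_uminus)
    ultimately have "pprt (l *\<^sub>R b - inf f g) \<le> pprt ?u + pprt ?v"
      unfolding pprt_def[of "l *\<^sub>R b - inf f g"] by (simp only:) (intro le_supI add_nonneg_nonneg zero_le_pprt)
    then show "inf \<bar>k\<bar> (pprt (l *\<^sub>R b - inf f g)) = 0"
      using k b by - (rule inf_add_eq_0[of "\<bar>k\<bar>" "pprt ?u" "pprt ?v"], auto simp: level_iff)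
  qed
qed

text \<open>A nonzero element of the complement is outside the level itself, so some
  \<open>b\<close> of the ball has \<open>l b > f\<close> on a nonzero part of
  \<open>k\<close>.\<close>

lemma polar_level_witness:
  assumes k: "k \<in> polar (level f l)" "0 \<le> k" "k \<noteq> 0"
  obtains b where "b \<in> pos_ball norm" "inf k (pprt (l *\<^sub>R b - f)) \<noteq> 0"
proof -
  have "k \<notin> level f l" using k Int_polar[OF level_in_polars] by blast
  then show thesis using that k(2) by (auto simp: level_iff abs_of_nonneg)
qed

text \<open>A nonzero \<open>k\<close> in the intersection is shrunk twice, to a part
  \<open>h'\<close> on which \<open>f < l b\<close> and \<open>g < m c\<close>. Since
  \<open>l\<close> and \<open>m\<close> are nonnegative, \<open>d = sup b c\<close> replaces both
  witnesses, giving \<open>f + g < (l + m) d\<close> on \<open>h'\<close>. This contradicts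
  membership of \<open>k\<close> in the level of the sum.\<close>

lemma level_add_upper:
  assumes "0 \<le> l" "0 \<le> m"
  shows "polar (level f l) \<inter> polar (level g m) \<inter> level (f + g) (l + m) = {0}"
proof -
  have "k = 0" if "k \<in> polar (level f l)" "k \<in> polar (level g m)" "k \<in> level (f + g) (l + m)" for k
  proof (rule ccontr)
    assume "k \<noteq> 0"
    have k: "\<bar>k\<bar> \<in> polar (level f l)" "\<bar>k\<bar> \<noteq> 0"
      using polars_solid[OF polar_in_polars that(1), of "\<bar>k\<bar>"] \<open>k \<noteq> 0\<close> by simp_all
    obtain b where b: "b \<in> pos_ball norm" "inf \<bar>k\<bar> (pprt (l *\<^sub>R b - f)) \<noteq> 0"
      by (rule polar_level_witness[OF k(1) abs_ge_zero k(2)])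
    define h where "h = inf \<bar>k\<bar> (pprt (l *\<^sub>R b - f))"
    have h: "0 \<le> h" "h \<noteq> 0" "h \<le> \<bar>k\<bar>" "h \<le> pprt (l *\<^sub>R b - f)" using b(2) by (simp_all add: h_def)
    have hg: "h \<in> polar (level g m)"
      using polars_solid[OF polar_in_polars that(2), of h] h by (simp add: abs_of_nonneg)
    obtain c where c: "c \<in> pos_ball norm" "inf h (pprt (m *\<^sub>R c - g)) \<noteq> 0"
      by (rule polar_level_witness[OF hg h(1,2)])
    define h' where "h' = inf h (pprt (m *\<^sub>R c - g))"
    have h': "0 \<le> h'" "h' \<noteq> 0" "h' \<le> h" "h' \<le> pprt (m *\<^sub>R c - g)" using c(2) h(1) by (simp_all add: h'_def)
    define d where "d = sup b c"
    have d: "d \<in> pos_ball norm" unfolding d_def using b(1) c(1) by (rule pos_ball_sup)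
    have "pprt (l *\<^sub>R b - f) \<le> pprt (l *\<^sub>R d - f)"
      using assms by (intro pprt_mono diff_mono scaleR_left_mono) (simp_all add: d_def)
    then have 1: "h' \<le> pprt (l *\<^sub>R d - f)" using h(4) h'(3) by (meson order_trans)
    have "pprt (m *\<^sub>R c - g) \<le> pprt (m *\<^sub>R d - g)"
      using assms by (intro pprt_mono diff_mono scaleR_left_mono) (simp_all add: d_def)
    then have 2: "h' \<le> pprt (m *\<^sub>R d - g)" using h'(4) by (meson order_trans)
    have "h' \<le> pprt ((l *\<^sub>R d - f) + (m *\<^sub>R d - g))" using h'(1) 1 2 by (rule le_pprt_add_if_le_pprt)
    also have "(l *\<^sub>R d - f) + (m *\<^sub>R d - g) = (l + m) *\<^sub>R d - (f + g)" by (simp add: scaleR_add_left)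
    finally have "h' \<le> inf \<bar>k\<bar> (pprt ((l + m) *\<^sub>R d - (f + g)))"
      using h'(3) h(3) by (meson le_infI order_trans)
    moreover have "inf \<bar>k\<bar> (pprt ((l + m) *\<^sub>R d - (f + g))) = 0"
      using that(3) d unfolding level_iff by blast
    ultimately have "h' \<le> 0" by (simp only:)
    then show False using h'(1,2) by (meson antisym)
  qed
  moreover have "0 \<in> polar (level f l) \<inter> polar (level g m) \<inter> level (f + g) (l + m)"
    by (intro IntI zero_in_polars) simp_all
  ultimately show ?thesis by blast
qed

section \<open>The representation\<close>

text \<open>Intended for \<open>0 \<le> f\<close> at Stone points, where the set contains every
  \<open>l \<le> 0\<close> and is bounded by \<open>norm f\<close>.\<close>

definition rep_pos :: "'a::am_space \<Rightarrow> 'a set set \<Rightarrow> real"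
  where "rep_pos f x = Sup {l. level f l \<in> x}"

context
  fixes x :: "'a::am_space set set"
  assumes x: "x \<in> stone_points"
begin

lemma level_le_norm: "0 \<le> f \<Longrightarrow> level f l \<in> x \<Longrightarrow> l \<le> norm f"
  using level_above_norm stone_point_nonzero[OF x] by (metis not_le)

lemma le_rep_pos: "0 \<le> f \<Longrightarrow> level f l \<in> x \<Longrightarrow> l \<le> rep_pos f x"
  unfolding rep_pos_def using level_le_norm by (intro cSup_upper bdd_aboveI[of _ "norm f"]) auto

lemma rep_pos_nonneg: "0 \<le> f \<Longrightarrow> 0 \<le> rep_pos f x"
  using level_nonpos[of f 0] stone_point_UNIV[OF x] by (intro le_rep_pos) simp_all

lemma less_rep_pos: "0 \<le> f \<Longrightarrow> l < rep_pos f x \<Longrightarrow> level f l \<in> x"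
proof -
  assume f: "0 \<le> f" and l: "l < rep_pos f x"
  have "level f 0 \<in> x" using level_nonpos[OF f, of 0] stone_point_UNIV[OF x] by simp
  then have "{l. level f l \<in> x} \<noteq> {}" by blast
  moreover have "bdd_above {l. level f l \<in> x}" using level_le_norm[OF f] by (intro bdd_aboveI[of _ "norm f"]) auto
  ultimately obtain m where "level f m \<in> x" "l < m"
    using l less_cSup_iff[of "{l. level f l \<in> x}" l] by (auto simp: rep_pos_def)
  then show "level f l \<in> x"
    using stone_point_mono[OF x _ level_in_polars level_antimono] by (metis less_imp_le)
qed

lemma rep_pos_le_norm:
  assumes "0 \<le> f"
  shows "rep_pos f x \<le> norm f"
proof (rule dense_le)
  show "l \<le> norm f" if "l < rep_pos f x" for l
    using less_rep_pos[OF assms that] by (rule level_le_norm[OF assms])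
qed

lemma rep_pos_le: "0 \<le> f \<Longrightarrow> level f l \<notin> x \<Longrightarrow> rep_pos f x \<le> l"
  using less_rep_pos by (metis not_le)

lemma rep_pos_add:
  assumes f: "0 \<le> f" and g: "0 \<le> g"
  shows "rep_pos (f + g) x = rep_pos f x + rep_pos g x"
proof -
  have fg: "0 \<le> f + g" using f g by simp
  show ?thesis
  proof (rule antisym)
    show "rep_pos f x + rep_pos g x \<le> rep_pos (f + g) x"
    proof (rule field_le_epsilon)
      fix e :: real assume e: "0 < e"
      have "level f (rep_pos f x - e / 2) \<in> x" "level g (rep_pos g x - e / 2) \<in> x"
        using e by (auto intro!: less_rep_pos f g)
      then have "level f (rep_pos f x - e / 2) \<inter> level g (rep_pos g x - e / 2) \<in> x"
        by (rule stone_point_Int[OF x])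
      then have "level (f + g) ((rep_pos f x - e / 2) + (rep_pos g x - e / 2)) \<in> x"
        by (rule stone_point_mono[OF x _ level_in_polars level_add])
      then have "(rep_pos f x - e / 2) + (rep_pos g x - e / 2) \<le> rep_pos (f + g) x"
        by (rule le_rep_pos[OF fg])
      then show "rep_pos f x + rep_pos g x \<le> rep_pos (f + g) x + e" by simp
    qed
    show "rep_pos (f + g) x \<le> rep_pos f x + rep_pos g x"
    proof (rule field_le_epsilon)
      fix e :: real assume e: "0 < e"
      \<comment> \<open>Strictly above the values the levels are not in \<open>x\<close>, so their
        complements are; nonnegativity of the values makes \<open>l\<close> and \<open>m\<close>
        admissible in \<open>level_add_upper\<close>.\<close>
      define l where "l = rep_pos f x + e / 2"
      define m where "m = rep_pos g x + e / 2"
      have lm: "0 \<le> l" "0 \<le> m" using rep_pos_nonneg f g e by (simp_all add: l_def m_def add_nonneg_nonneg)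
      have "level f l \<notin> x" "level g m \<notin> x"
        using le_rep_pos[OF f, of l] le_rep_pos[OF g, of m] e by (auto simp: l_def m_def)
      then have "polar (level f l) \<in> x" "polar (level g m) \<in> x"
        by (simp_all add: stone_point_polar_iff[OF x])
      then have "polar (level f l) \<inter> polar (level g m) \<in> x" by (rule stone_point_Int[OF x])
      then have "level (f + g) (l + m) \<notin> x"
        using level_add_upper[OF lm, of f g] stone_point_Int[OF x] stone_point_nonzero[OF x] by metis
      then have "rep_pos (f + g) x \<le> l + m" by (rule rep_pos_le[OF fg])
      then show "rep_pos (f + g) x \<le> rep_pos f x + rep_pos g x + e" by (simp add: l_def m_def)
    qed
  qed
qed

lemma rep_pos_0: "rep_pos 0 x = 0"
  using rep_pos_le_norm[of 0] rep_pos_nonneg[of 0] by simp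

lemma rep_pos_scaleR_ge:
  assumes "0 \<le> f" "0 < c"
  shows "c * rep_pos f x \<le> rep_pos (c *\<^sub>R f) x"
proof (rule dense_le)
  fix l assume "l < c * rep_pos f x"
  then have "l / c < rep_pos f x" using assms by (simp add: field_simps)
  then have "level f (l / c) \<in> x" by (rule less_rep_pos[OF assms(1)])
  then have "level (c *\<^sub>R f) (c * (l / c)) \<in> x"
    by (rule stone_point_mono[OF x _ level_in_polars level_scaleR[OF assms(2)]])
  then have "c * (l / c) \<le> rep_pos (c *\<^sub>R f) x"
    using assms by (intro le_rep_pos) (simp_all add: scaleR_nonneg_nonneg)
  then show "l \<le> rep_pos (c *\<^sub>R f) x" using assms by simp
qed

lemma rep_pos_scaleR:
  assumes f: "0 \<le> f" and c: "0 \<le> c"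
  shows "rep_pos (c *\<^sub>R f) x = c * rep_pos f x"
proof (cases "c = 0")
  case False
  then have c: "0 < c" using c by simp
  have "inverse c * rep_pos (c *\<^sub>R f) x \<le> rep_pos (inverse c *\<^sub>R (c *\<^sub>R f)) x"
    using f c by (intro rep_pos_scaleR_ge) (simp_all add: scaleR_nonneg_nonneg)
  then have "rep_pos (c *\<^sub>R f) x \<le> c * rep_pos f x" using c by (simp add: field_simps)
  then show ?thesis using rep_pos_scaleR_ge[OF f c] by (rule antisym)
qed (simp add: rep_pos_0)

text \<open>If both values exceeded some \<open>l > 0\<close>, the intersection of the two levels
  would belong to \<open>x\<close>; but it lies in the level of \<open>inf f g = 0\<close> at
  \<open>l\<close>, which is trivial.\<close>

lemma rep_pos_disjoint:
  assumes f: "0 \<le> f" and g: "0 \<le> g" and dis: "inf f g = 0"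
  shows "rep_pos f x = 0 \<or> rep_pos g x = 0"
proof (rule ccontr)
  assume "\<not> ?thesis"
  then have "0 < min (rep_pos f x) (rep_pos g x)"
    using rep_pos_nonneg[OF f] rep_pos_nonneg[OF g] by simp
  then obtain l where l: "0 < l" "l < rep_pos f x" "l < rep_pos g x"
    using dense[of 0 "min (rep_pos f x) (rep_pos g x)"] by auto
  have "level f l \<inter> level g l \<in> x"
    using less_rep_pos[OF f l(2)] less_rep_pos[OF g l(3)] by (rule stone_point_Int[OF x])
  then have "level 0 l \<in> x"
    using stone_point_mono[OF x _ level_in_polars level_inf[of f l g]] dis by simp
  then show False using level_above_norm[of 0 l] l(1) stone_point_nonzero[OF x] by auto
qed

text \<open>If \<open>A\<close> is not in \<open>x\<close>, its complement is, and the complement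
  meets every positive level of \<open>h\<close> only in \<open>0\<close>. This localises images of
  elements of a band, as needed for order density.\<close>

lemma rep_pos_eq_0_off_band:
  assumes h: "0 \<le> h" "h \<in> A" and A: "A \<in> polars" "A \<notin> x"
  shows "rep_pos h x = 0"
proof (rule ccontr)
  assume "rep_pos h x \<noteq> 0"
  then have "0 < rep_pos h x" using rep_pos_nonneg[OF h(1)] by simp
  then obtain l where l: "0 < l" "l < rep_pos h x" using dense by blast
  have "k = 0" if "k \<in> level h l" "k \<in> polar A" for k
  proof (rule level_disjoint[OF that(1) h(1) _ l(1)])
    have "inf \<bar>k\<bar> \<bar>h\<bar> = 0" using that(2) h(2) by (simp add: polar_def)
    then show "inf \<bar>k\<bar> h = 0" using h(1) by (simp add: abs_of_nonneg)
  qed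
  then have "level h l \<inter> polar A \<subseteq> {0}" by blast
  moreover have "0 \<in> level h l \<inter> polar A" by (intro IntI zero_in_polars) simp_all
  ultimately have "level h l \<inter> polar A = {0}" by blast
  moreover have "level h l \<inter> polar A \<in> x"
    using less_rep_pos[OF h(1) l(2)] stone_point_polar_iff[OF x A(1)] A(2)
    by (intro stone_point_Int[OF x]) simp_all
  ultimately show False using stone_point_nonzero[OF x] by metis
qed

end

text \<open>A level strictly between \<open>a\<close> and the value at \<open>x\<close> supplies the
  basic neighbourhood: the level itself for lower semicontinuity, its complement for upper
  semicontinuity.\<close>

lemma continuous_map_rep_pos:
  assumes f: "0 \<le> f"
  shows "continuous_map stone_space euclideanreal (rep_pos f)"
  unfolding continuous_map_upper_lower_semicontinuous_lt topspace_stone_space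
proof (intro conjI allI)
  fix a
  show "openin stone_space {x \<in> stone_points. a < rep_pos f x}"
    unfolding openin_stone_space
  proof (intro conjI ballI)
    fix x assume "x \<in> {x \<in> stone_points. a < rep_pos f x}"
    then have x: "x \<in> stone_points" "a < rep_pos f x" by auto
    then obtain l where l: "a < l" "l < rep_pos f x" using dense by blast
    have "a < rep_pos f y" if "y \<in> stone_points" "level f l \<in> y" for y
      using le_rep_pos[OF that(1) f that(2)] l by simp
    then show "\<exists>A\<in>x. {y \<in> stone_points. A \<in> y} \<subseteq> {x \<in> stone_points. a < rep_pos f x}"
      using less_rep_pos[OF x(1) f l(2)] by (intro bexI[of _ "level f l"]) auto
  qed auto
  show "openin stone_space {x \<in> stone_points. rep_pos f x < a}"
    unfolding openin_stone_space
  proof (intro conjI ballI)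
    fix x assume "x \<in> {x \<in> stone_points. rep_pos f x < a}"
    then have x: "x \<in> stone_points" "rep_pos f x < a" by auto
    then obtain l where l: "rep_pos f x < l" "l < a" using dense by blast
    have "rep_pos f y < a" if "y \<in> stone_points" "polar (level f l) \<in> y" for y
      using rep_pos_le[OF that(1) f] stone_point_polar_iff[OF that(1)] that(2) l(2)
      by (metis level_in_polars le_less_trans)
    moreover have "polar (level f l) \<in> x"
      using stone_point_polar_iff[OF x(1)] le_rep_pos[OF x(1) f] l(1) by (metis level_in_polars not_le)
    ultimately show "\<exists>A\<in>x. {y \<in> stone_points. A \<in> y} \<subseteq> {x \<in> stone_points. rep_pos f x < a}"
      by (intro bexI[of _ "polar (level f l)"]) auto
  qed auto
qed

section \<open>Extension from the positive cone to a lattice homomorphism\<close>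

definition rep :: "'a::am_space \<Rightarrow> 'a set set \<Rightarrow> real"
  where "rep f = (\<lambda>x. if x \<in> stone_points then rep_pos (pprt f) x - rep_pos (pprt (- f)) x else 0)"

text \<open>The value does not depend on the decomposition: two decompositions of the same element
  give equal sums on the cone, where additivity applies. Linearity of \<open>rep\<close> rests on
  this freedom.\<close>

lemma rep_diff:
  assumes x: "x \<in> stone_points" and uv: "0 \<le> u" "0 \<le> v"
  shows "rep (u - v) x = rep_pos u x - rep_pos v x"
proof -
  let ?f = "u - v"
  have "pprt ?f + v = u + pprt (- ?f)"
    using pprt_minus_pprt[of ?f] by (metis add.commute diff_add_eq diff_eq_eq)
  then have "rep_pos (pprt ?f) x + rep_pos v x = rep_pos u x + rep_pos (pprt (- ?f)) x"
    using uv rep_pos_add[OF x, of "pprt ?f" v] rep_pos_add[OF x, of u "pprt (- ?f)"]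
    by (metis zero_le_pprt)
  then show ?thesis using x by (simp add: rep_def)
qed

lemma rep_nonneg: "x \<in> stone_points \<Longrightarrow> 0 \<le> f \<Longrightarrow> rep f x = rep_pos f x"
  using rep_diff[of x f 0] by (simp add: rep_pos_0)

lemma rep_in_CK: "rep f \<in> CK stone_space"
proof -
  have "continuous_map stone_space euclideanreal (rep f)"
    by (rule continuous_map_eq[of _ _ "\<lambda>x. rep_pos (pprt f) x - rep_pos (pprt (- f)) x"])
      (auto simp: rep_def topspace_stone_space intro!: continuous_map_diff continuous_map_rep_pos)
  then show ?thesis by (simp add: CK_def topspace_stone_space rep_def)
qed

lemma rep_add: "rep (f + g) = rep f + rep g"
proof
  fix x
  show "rep (f + g) x = (rep f + rep g) x"
  proof (cases "x \<in> stone_points")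
    case x: True
    have "f + g = (pprt f + pprt g) - (pprt (- f) + pprt (- g))"
      using pprt_minus_pprt[of f] pprt_minus_pprt[of g] by (metis add_diff_add)
    then have "rep (f + g) x = rep_pos (pprt f + pprt g) x - rep_pos (pprt (- f) + pprt (- g)) x"
      using rep_diff[OF x, of "pprt f + pprt g" "pprt (- f) + pprt (- g)"] by simp
    then show ?thesis using x by (simp add: rep_pos_add rep_def plus_fun_def)
  qed (simp add: rep_def plus_fun_def)
qed

lemma rep_scaleR: "rep (c *\<^sub>R f) = c *\<^sub>R rep f"
proof
  fix x
  show "rep (c *\<^sub>R f) x = (c *\<^sub>R rep f) x"
  proof (cases "x \<in> stone_points")
    case x: True
    show ?thesis
    proof (cases "0 \<le> c")
      case True
      have "c *\<^sub>R f = c *\<^sub>R pprt f - c *\<^sub>R pprt (- f)"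
        using pprt_minus_pprt[of f] by (metis scaleR_diff_right)
      then have "rep (c *\<^sub>R f) x = rep_pos (c *\<^sub>R pprt f) x - rep_pos (c *\<^sub>R pprt (- f)) x"
        using rep_diff[OF x, of "c *\<^sub>R pprt f" "c *\<^sub>R pprt (- f)"] True
        by (simp add: scaleR_nonneg_nonneg)
      then show ?thesis using x True by (simp add: rep_pos_scaleR rep_def scaleR_fun_def right_diff_distrib)
    next
      case False
      then have c: "0 \<le> - c" by simp
      have "c *\<^sub>R f = (- c) *\<^sub>R pprt (- f) - (- c) *\<^sub>R pprt f"
        using arg_cong[OF pprt_minus_pprt[of f], of "\<lambda>f. c *\<^sub>R f"] by (simp add: scaleR_diff_right)
      then have "rep (c *\<^sub>R f) x = rep_pos ((- c) *\<^sub>R pprt (- f)) x - rep_pos ((- c) *\<^sub>R pprt f) x"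
        using rep_diff[OF x, of "(- c) *\<^sub>R pprt (- f)" "(- c) *\<^sub>R pprt f"] c
        by (metis scaleR_nonneg_nonneg zero_le_pprt)
      then have "rep (c *\<^sub>R f) x = (- c) * rep_pos (pprt (- f)) x - (- c) * rep_pos (pprt f) x"
        using rep_pos_scaleR[OF x _ c] by (metis zero_le_pprt)
      then show ?thesis using x by (simp add: rep_def scaleR_fun_def right_diff_distrib)
    qed
  qed (simp add: rep_def scaleR_fun_def)
qed

lemma linear_rep: "linear rep"
  by (intro linearI rep_add rep_scaleR)

text \<open>The positive and the negative part of \<open>h\<close> are disjoint, so at each point
  one of them has value \<open>0\<close>.\<close>

lemma rep_pprt: "rep (pprt h) x = max (rep h x) 0"
proof (cases "x \<in> stone_points")
  case x: True
  have "rep_pos (pprt h) x = 0 \<or> rep_pos (pprt (- h)) x = 0"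
    by (intro rep_pos_disjoint[OF x] inf_pprt_pprt_uminus) simp_all
  then show ?thesis
    using x rep_nonneg[OF x, of "pprt h"] rep_pos_nonneg[OF x, of "pprt h"] rep_pos_nonneg[OF x, of "pprt (- h)"]
    by (auto simp: rep_def)
qed (simp add: rep_def)

lemma rep_sup: "rep (sup f g) = sup (rep f) (rep g)"
proof
  fix x
  have "sup f g = f + pprt (g - f)" by (simp add: pprt_def add_sup_distrib_left sup_commute)
  then have "rep (sup f g) x = rep f x + max (rep g x - rep f x) 0"
    using linear_diff[OF linear_rep, of g f] by (simp add: rep_add rep_pprt plus_fun_def fun_diff_def)
  then show "rep (sup f g) x = sup (rep f) (rep g) x" by (simp add: sup_max)
qed

lemma lattice_hom_rep: "lattice_hom rep"
  unfolding lattice_hom_def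
proof (intro conjI allI)
  fix f g :: 'a
  have "rep (inf f g) = - rep (sup (- f) (- g))"
    by (simp only: inf_eq_neg_sup[of f g] linear_neg[OF linear_rep])
  also have "\<dots> = - sup (- rep f) (- rep g)"
    by (simp only: rep_sup linear_neg[OF linear_rep])
  also have "\<dots> = inf (rep f) (rep g)"
    by (rule ext) (simp add: sup_max inf_min max_def min_def)
  finally show "rep (inf f g) = inf (rep f) (rep g)" .
qed (rule linear_rep rep_sup)+

section \<open>Comparison of the norm with the sup norm of the image\<close>

lemma sup_norm_rep_le: "sup_norm stone_space (rep f) \<le> norm f"
proof -
  have "\<bar>rep f x\<bar> \<le> norm f" for x
  proof (cases "x \<in> stone_points")
    case x: True
    have "\<bar>rep f x\<bar> = rep_pos \<bar>f\<bar> x"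
      using lattice_hom_abs[OF lattice_hom_rep, of f x] rep_nonneg[OF x, of "\<bar>f\<bar>"] by simp
    also have "\<dots> \<le> norm \<bar>f\<bar>" by (rule rep_pos_le_norm[OF x]) simp
    also have "\<dots> \<le> norm f" by (rule norm_solid) simp
    finally show ?thesis .
  qed (simp add: rep_def)
  then show ?thesis using sup_norm_le_iff[OF compact_stone_space rep_in_CK] by (metis norm_ge_zero)
qed

text \<open>A nontrivial level would belong to some point, and there the image would be at least
  \<open>l\<close>. A bound in $C(K)$ is thus turned back into an order statement in
  \<open>F\<close>.\<close>

lemma level_above_sup_norm_rep:
  assumes f: "0 \<le> f" and l: "sup_norm stone_space (rep f) < l"
  shows "level f l = {0}"
proof (rule ccontr)
  assume "level f l \<noteq> {0}"
  from polar_extends[OF level_in_polars this]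
  obtain x where x: "x \<in> stone_points" "level f l \<in> x" by (elim bexE)
  have "l \<le> rep f x" using le_rep_pos[OF x(1) f x(2)] rep_nonneg[OF x(1) f] by simp
  also have "\<dots> \<le> sup_norm stone_space (rep f)"
    using abs_le_sup_norm[OF compact_stone_space rep_in_CK, of f x] by linarith
  finally show False using l by simp
qed

text \<open>If \<open>u\<close> bounds all truncations, then \<open>f - inf f u\<close> is at most
  \<open>f - inf f (l b)\<close>. The latter is disjoint from the positive part of
  \<open>l b - f\<close>, so \<open>f - inf f u\<close> lies in \<open>level f l\<close> and
  vanishes. The truncations have norm at most \<open>l\<close>, which brings them within reach of
  the demicontinuity hypotheses.\<close>

lemma directed_up_to_truncations:
  assumes f: "0 \<le> f" and l: "0 < l" and lev: "level f l = {0}"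
  shows "(\<lambda>b. inf f (l *\<^sub>R b)) ` pos_ball norm \<up> f"
    and "(\<lambda>b. inf f (l *\<^sub>R b)) ` pos_ball norm \<subseteq> (*\<^sub>R) l ` pos_ball norm"
proof -
  let ?P = "(\<lambda>b. inf f (l *\<^sub>R b)) ` pos_ball norm"
  have Lub: "f \<le> u" if u: "\<And>b. b \<in> pos_ball norm \<Longrightarrow> inf f (l *\<^sub>R b) \<le> u" for u
  proof -
    have "f - inf f u \<in> level f l" unfolding level_iff
    proof
      fix b :: 'a assume b: "b \<in> pos_ball norm"
      let ?m = "inf f (l *\<^sub>R b)"
      have "inf (f - ?m) (l *\<^sub>R b - ?m) = 0"
        by (metis add_inf_distrib_right diff_conv_add_uminus diff_self)
      moreover have nonneg: "0 \<le> f - inf f u" "0 \<le> l *\<^sub>R b - ?m"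
        by (simp_all only: diff_ge_0_iff_ge inf_le1 inf_le2)
      moreover have "f - inf f u \<le> f - ?m" using u[OF b] by (intro diff_left_mono) simp
      ultimately have "inf (f - inf f u) (l *\<^sub>R b - ?m) = 0" by (meson inf_mono_0 order_refl)
      moreover have "pprt (l *\<^sub>R b - f) = l *\<^sub>R b - ?m"
        by (simp add: pprt_def diff_inf_eq_sup add_sup_distrib_left)
      moreover have "\<bar>f - inf f u\<bar> = f - inf f u" using nonneg(1) by (rule abs_of_nonneg)
      ultimately show "inf \<bar>f - inf f u\<bar> (pprt (l *\<^sub>R b - f)) = 0" by (simp only:)
    qed
    then have "f - inf f u = 0" using lev by (simp only: singleton_iff)
    then have "f = inf f u" by (simp only: right_minus_eq)
    then show "f \<le> u" by (simp add: le_iff_inf)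
  qed
  have zero: "(0::'a) \<in> pos_ball norm" by (simp add: pos_ball_def)
  show "?P \<up> f" unfolding directed_up_to_def
  proof (intro conjI ballI)
    show "?P \<noteq> {}" using zero by blast
    show "isLub UNIV ?P f"
      using Lub by (auto simp: isLub_def leastP_def isUb_def setle_def setge_def)
    fix p q assume "p \<in> ?P" "q \<in> ?P"
    then obtain b c where b: "b \<in> pos_ball norm" "p = inf f (l *\<^sub>R b)"
      and c: "c \<in> pos_ball norm" "q = inf f (l *\<^sub>R c)" by blast
    have "l *\<^sub>R b \<le> l *\<^sub>R sup b c" "l *\<^sub>R c \<le> l *\<^sub>R sup b c"
      using l by (auto intro: scaleR_left_mono)
    then have "p \<le> inf f (l *\<^sub>R sup b c)" "q \<le> inf f (l *\<^sub>R sup b c)"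
      unfolding b(2) c(2) by (auto intro: le_infI2)
    then show "\<exists>r\<in>?P. p \<le> r \<and> q \<le> r" using pos_ball_sup[OF b(1) c(1)] by blast
  qed
  show "?P \<subseteq> (*\<^sub>R) l ` pos_ball norm"
  proof
    fix p assume "p \<in> ?P"
    then obtain b where b: "b \<in> pos_ball norm" "p = inf f (l *\<^sub>R b)" by blast
    have p: "0 \<le> p" using b f l by (simp add: pos_ball_def scaleR_nonneg_nonneg)
    have "norm p \<le> norm (l *\<^sub>R b)" using p b(2) by (intro norm_mono_nonneg) simp_all
    also have "\<dots> \<le> l" using b(1) l by (simp add: pos_ball_def)
    finally have "p /\<^sub>R l \<in> pos_ball norm" using p l by (simp add: pos_ball_def scaleR_nonneg_nonneg field_simps)
    moreover have "p = l *\<^sub>R (p /\<^sub>R l)" using l by simp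
    ultimately show "p \<in> (*\<^sub>R) l ` pos_ball norm" by blast
  qed
qed

lemma r_demicontinuous_scaled:
  fixes f :: "'a::am_space"
  assumes r: "r_demicontinuous r (norm :: 'a \<Rightarrow> real)" and s: "0 < s"
    and P: "P \<subseteq> (*\<^sub>R) s ` pos_ball norm" "P \<up> f"
  shows "norm f \<le> r * s"
proof -
  let ?Q = "(\<lambda>p. p /\<^sub>R s) ` P"
  have iff: "p /\<^sub>R s \<le> q \<longleftrightarrow> p \<le> s *\<^sub>R q" for p q :: 'a using s by (simp add: pos_divideR_le_eq)
  have mono: "p /\<^sub>R s \<le> q /\<^sub>R s" if "p \<le> q" for p q :: 'a using s that by (intro scaleR_left_mono) simp_all
  have "?Q \<subseteq> pos_ball norm" using P(1) s by (auto simp: subset_iff image_iff)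
  moreover have "?Q \<up> (f /\<^sub>R s)" unfolding directed_up_to_def
  proof (intro conjI ballI)
    show "?Q \<noteq> {}" using directed_up_to_Lub(1)[OF P(2)] by blast
    have "f /\<^sub>R s \<le> u" if "\<And>p. p \<in> P \<Longrightarrow> p /\<^sub>R s \<le> u" for u
      using that directed_up_to_Lub(3)[OF P(2)] iff by metis
    moreover have "p /\<^sub>R s \<le> f /\<^sub>R s" if "p \<in> P" for p
      using mono directed_up_to_Lub(2)[OF P(2)] that by blast
    ultimately show "isLub UNIV ?Q (f /\<^sub>R s)"
      by (auto simp: isLub_def leastP_def isUb_def setle_def setge_def)
    fix p' q' assume "p' \<in> ?Q" "q' \<in> ?Q"
    then obtain p q where pq: "p \<in> P" "q \<in> P" "p' = p /\<^sub>R s" "q' = q /\<^sub>R s" by blast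
    then obtain t where "t \<in> P" "p \<le> t" "q \<le> t" using P(2) unfolding directed_up_to_def by meson
    then show "\<exists>t\<in>?Q. p' \<le> t \<and> q' \<le> t" using mono pq by blast
  qed
  ultimately have "norm (f /\<^sub>R s) \<le> r" using r unfolding r_demicontinuous_def by meson
  then show ?thesis using s by (simp add: field_simps)
qed

lemma sup_norm_rep_abs: "sup_norm stone_space (rep \<bar>f\<bar>) = sup_norm stone_space (rep f)"
  by (simp add: sup_norm_def lattice_hom_abs[OF lattice_hom_rep])

lemma norm_le_sup_norm_rep:
  fixes f :: "'a::am_space"
  assumes r: "r_demicontinuous r (norm :: 'a \<Rightarrow> real)" "0 \<le> r"
  shows "norm f \<le> r * sup_norm stone_space (rep f)"
proof (rule field_le_epsilon)
  fix e :: real assume e: "0 < e"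
  let ?s = "sup_norm stone_space (rep f)"
  \<comment> \<open>Any \<open>l\<close> above the sup norm makes the truncations available; the
    denominator \<open>r + 1\<close> is positive even for \<open>r = 0\<close> and keeps
    \<open>r * l\<close> within \<open>e\<close> of \<open>r * ?s\<close>.\<close>
  define l where "l = ?s + e / (r + 1)"
  have l: "?s < l" using e r(2) by (simp add: l_def)
  have l0: "0 < l" using l sup_norm_nonneg[OF compact_stone_space rep_in_CK, of f] by linarith
  have lev: "level \<bar>f\<bar> l = {0}"
    using l by (intro level_above_sup_norm_rep) (simp_all add: sup_norm_rep_abs)
  have "norm \<bar>f\<bar> \<le> r * l"
    using directed_up_to_truncations[OF _ l0 lev] by (intro r_demicontinuous_scaled[OF r(1) l0]) simp_all
  also have "\<dots> \<le> r * ?s + e" using e r(2) by (simp add: l_def field_simps)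
  finally show "norm f \<le> r * ?s + e" by simp
qed

section \<open>Order density of the representation\<close>

lemma r_demicontinuous_imp_pointwise:
  assumes r: "r_demicontinuous r (norm :: 'a::am_space \<Rightarrow> real)" "0 < r"
  shows "pointwise_demicontinuous (norm :: 'a \<Rightarrow> real)"
  unfolding pointwise_demicontinuous_def
proof (intro allI impI)
  fix f :: 'a assume f: "0 < f"
  show "\<exists>t>0. \<forall>P s. P \<subseteq> (*\<^sub>R) s ` pos_ball norm \<and> P \<up> f \<longrightarrow> t \<le> s"
  proof (intro exI[of _ "norm f / r"] conjI allI impI)
    show "0 < norm f / r" using f r(2) by simp
    fix P s assume P: "P \<subseteq> (*\<^sub>R) s ` pos_ball norm \<and> P \<up> f"
    then have "0 < s" using f scale_pos_if_directed_up_to by metis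
    then have "norm f \<le> r * s" using P r_demicontinuous_scaled[OF r(1), of s P f] by blast
    then show "norm f / r \<le> s" using r(2) by (simp add: field_simps)
  qed
qed

text \<open>If \<open>f \<noteq> 0\<close> had image \<open>0\<close>, every positive level of
  \<open>\<bar>f\<bar>\<close> would be trivial. At \<open>t / 2\<close> the truncations then
  exhibit \<open>\<bar>f\<bar>\<close> as a directed supremum from \<open>t / 2\<close> times the
  ball, below the threshold \<open>t\<close>.\<close>

lemma embedding_rep:
  assumes pd: "pointwise_demicontinuous (norm :: 'a::am_space \<Rightarrow> real)"
  shows "embedding stone_space (rep :: 'a \<Rightarrow> _)"
proof -
  have "f = 0" if f: "rep f = 0" for f :: 'a
  proof (rule ccontr)
    assume "f \<noteq> 0"
    then have "0 < \<bar>f\<bar>" by simp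
    from pd[unfolded pointwise_demicontinuous_def, rule_format, OF this]
    obtain t where t: "0 < t"
      "\<And>P s. P \<subseteq> (*\<^sub>R) s ` pos_ball norm \<Longrightarrow> P \<up> \<bar>f\<bar> \<Longrightarrow> t \<le> s"
      by blast
    have "sup_norm stone_space (rep f) = 0"
      using sup_norm_le_iff[OF compact_stone_space rep_in_CK, of 0 f]
        sup_norm_nonneg[OF compact_stone_space rep_in_CK, of f] f by (simp add: zero_fun_def)
    then have lev: "level \<bar>f\<bar> (t / 2) = {0}"
      using t(1) by (intro level_above_sup_norm_rep) (simp_all add: sup_norm_rep_abs)
    have "t \<le> t / 2"
      using t(2) directed_up_to_truncations[OF abs_ge_zero half_gt_zero[OF t(1)] lev] by blast
    then show False using t(1) by simp
  qed
  then have "inj (rep :: 'a \<Rightarrow> _)" by (simp add: linear_injective_0[OF linear_rep])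
  then show ?thesis using lattice_hom_rep rep_in_CK by (auto simp: embedding_def)
qed

lemma sublattice_range:
  assumes T: "embedding K T"
  shows "sublattice (range T) (CK K)"
  unfolding sublattice_def
proof (intro conjI ballI)
  note hom = embedding_hom[OF T]
  show "range T \<subseteq> CK K" using T by (simp add: embedding_def)
  show "subspace (range T)" by (intro linear_subspace_image[OF lattice_hom_linear[OF hom]] subspace_UNIV)
  fix g h assume "g \<in> range T" "h \<in> range T"
  then obtain u v where "g = T u" "h = T v" by blast
  then have "sup g h = T (sup u v)" "inf g h = T (inf u v)" using hom by (simp_all add: lattice_hom_def)
  then show "sup g h \<in> range T" "inf g h \<in> range T" by simp_all
qed

text \<open>A positive \<open>g\<close> exceeds some \<open>c > 0\<close> on the basic set of a band
  \<open>A\<close>. A positive element of \<open>A\<close> with norm \<open>c\<close> has image at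
  most \<open>c\<close> there and \<open>0\<close> at all other points, hence below
  \<open>g\<close>.\<close>

lemma order_dense_rep:
  assumes pd: "pointwise_demicontinuous (norm :: 'a::am_space \<Rightarrow> real)"
  shows "order_dense_sublattice (range (rep :: 'a \<Rightarrow> _)) (CK stone_space)"
  unfolding order_dense_sublattice_def
proof (intro conjI ballI impI)
  note T = embedding_rep[OF pd]
  show "sublattice (range (rep :: 'a \<Rightarrow> _)) (CK stone_space)" by (rule sublattice_range[OF T])
  fix g :: "'a set set \<Rightarrow> real" assume g: "g \<in> CK stone_space" "0 < g"
  have g0: "0 \<le> g y" for y using g(2) by (auto simp: less_le le_fun_def)
  obtain x where gx: "0 < g x" using g(2) by (auto simp: less_fun_def le_fun_def not_le)
  then have x: "x \<in> stone_points" using g(1) by (force simp: CK_def topspace_stone_space)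
  \<comment> \<open>Half the value at \<open>x\<close> is positive and is still exceeded by
    \<open>g\<close> on a neighbourhood of \<open>x\<close>.\<close>
  define c where "c = g x / 2"
  have c: "0 < c" "c < g x" using gx by (simp_all add: c_def)
  have "openin stone_space {y \<in> stone_points. c < g y}"
    using g(1) unfolding CK_def continuous_map_upper_lower_semicontinuous_lt topspace_stone_space by simp
  then obtain A where A: "A \<in> x" "{y \<in> stone_points. A \<in> y} \<subseteq> {y \<in> stone_points. c < g y}"
    using x c unfolding openin_stone_space by blast
  have Ap: "A \<in> polars" using stone_point_polars[OF x A(1)] .
  obtain h0 where h0: "h0 \<in> A" "h0 \<noteq> 0"
    using stone_point_nonzero[OF x A(1)] zero_in_polars[OF Ap] by blast
  define h where "h = \<bar>h0\<bar>"
  have h: "h \<in> A" "h \<noteq> 0" "0 \<le> h" using h0 polars_solid[OF Ap h0(1), of h] by (simp_all add: h_def)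
  define e where "e = (c / norm h) *\<^sub>R h"
  have e: "0 \<le> e" "e \<noteq> 0" "norm e = c" using h c by (simp_all add: e_def scaleR_nonneg_nonneg)
  have "rep e y \<le> g y" for y
  proof (cases "y \<in> stone_points")
    case y: True
    show ?thesis
    proof (cases "A \<in> y")
      case True
      have "rep e y \<le> c" using rep_nonneg[OF y e(1)] rep_pos_le_norm[OF y e(1)] e(3) by simp
      moreover have "c < g y" using A(2) True y by blast
      ultimately show ?thesis by simp
    next
      case False
      then have "rep h y = 0" using rep_nonneg[OF y h(3)] rep_pos_eq_0_off_band[OF y h(3,1) Ap] by simp
      then show ?thesis using g0 by (simp add: e_def rep_scaleR scaleR_fun_def)
    qed
  qed (simp add: rep_def g0)
  then have "rep e \<le> g" by (simp add: le_fun_def)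
  moreover have "rep 0 \<le> rep e" using e(1) by (rule lattice_hom_mono[OF lattice_hom_rep])
  moreover have "rep e \<noteq> rep 0" using T e(2) by (auto simp: embedding_def dest: injD)
  moreover have "rep (0 :: 'a) = 0" by (rule linear_0[OF linear_rep])
  ultimately have "0 < rep e \<and> rep e \<le> g" by (simp add: less_le)
  then show "\<exists>e\<in>range (rep :: 'a \<Rightarrow> _). 0 < e \<and> e \<le> g" by blast
qed

lemma regular_rep:
  assumes "pointwise_demicontinuous (norm :: 'a::am_space \<Rightarrow> real)"
  shows "regular_sublattice (range (rep :: 'a \<Rightarrow> _)) (CK stone_space)"
  using order_dense_rep[OF assms] CK_sup_0 by (rule order_dense_imp_regular)

text \<open>The pulled-back sup norm is the candidate for the renorming: injectivity of
  \<open>T\<close> makes it definite, and preservation of absolute values makes it solid.\<close>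

lemma solid_norm_sup_norm:
  fixes T :: "'a::{vector_lattice,lattice_ab_group_add_abs} \<Rightarrow> 'k \<Rightarrow> real"
  assumes K: "compact_space K" and T: "embedding K T"
  shows "solid_norm (\<lambda>f. sup_norm K (T f))"
  unfolding solid_norm_def is_norm_def
proof (intro conjI allI impI)
  note hom = embedding_hom[OF T]
  note lin = lattice_hom_linear[OF hom]
  note le_iff = sup_norm_le_iff[OF K embedding_in_CK[OF T]]
  note le = abs_le_sup_norm[OF K embedding_in_CK[OF T]]
  note nonneg = sup_norm_nonneg[OF K embedding_in_CK[OF T]]
  fix f g :: 'a and c :: real
  show "0 \<le> sup_norm K (T f)" by (rule nonneg)
  show "sup_norm K (T f) = 0 \<longleftrightarrow> f = 0"
  proof
    assume "sup_norm K (T f) = 0"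
    then have "T f x = 0" for x using le[of f x] by simp
    then have "T f = T 0" using linear_0[OF lin] by (auto simp: zero_fun_def)
    then show "f = 0" using T by (auto simp: embedding_def dest: injD)
  next
    assume "f = 0"
    then have "sup_norm K (T f) \<le> 0" using le_iff[of 0 f] linear_0[OF lin] by simp
    then show "sup_norm K (T f) = 0" using nonneg[of f] by simp
  qed
  show "sup_norm K (T (f + g)) \<le> sup_norm K (T f) + sup_norm K (T g)"
  proof (subst le_iff)
    show "\<forall>x. \<bar>T (f + g) x\<bar> \<le> sup_norm K (T f) + sup_norm K (T g)"
    proof
      fix x
      show "\<bar>T (f + g) x\<bar> \<le> sup_norm K (T f) + sup_norm K (T g)"
        using le[of f x] le[of g x] by (simp add: linear_add[OF lin])
    qed
  qed (simp add: nonneg)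
  have scale_le: "sup_norm K (T (c *\<^sub>R f)) \<le> \<bar>c\<bar> * sup_norm K (T f)" for c f
    using le[of f] by (subst le_iff) (simp_all add: nonneg linear_scale[OF lin] scaleR_fun_def abs_mult mult_left_mono)
  show "sup_norm K (T (c *\<^sub>R f)) = \<bar>c\<bar> * sup_norm K (T f)"
  proof (rule antisym)
    show "\<bar>c\<bar> * sup_norm K (T f) \<le> sup_norm K (T (c *\<^sub>R f))"
    proof (cases "c = 0")
      case False
      then show ?thesis using scale_le[of "inverse c" "c *\<^sub>R f"] by (simp add: field_simps)
    qed (simp add: nonneg)
  qed (rule scale_le)
  assume "\<bar>f\<bar> \<le> \<bar>g\<bar>"
  then have "\<bar>T f x\<bar> \<le> \<bar>T g x\<bar>" for x
    using lattice_hom_mono[OF hom] by (metis lattice_hom_abs[OF hom] le_fun_def)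
  then show "sup_norm K (T f) \<le> sup_norm K (T g)"
    using le[of g] by (subst le_iff) (auto simp: nonneg intro: order_trans)
qed

section \<open>The three equivalences\<close>

lemma semicontinuous_imp_demicontinuous: "semicontinuous N \<Longrightarrow> demicontinuous N"
  unfolding semicontinuous_def demicontinuous_def by auto

lemma demicontinuous_imp_pointwise:
  "demicontinuous (norm :: 'a::am_space \<Rightarrow> real) \<Longrightarrow> pointwise_demicontinuous (norm :: 'a \<Rightarrow> real)"
  unfolding demicontinuous_def using r_demicontinuous_imp_pointwise by (metis less_le_trans zero_less_one)

context
  fixes R :: "('k \<Rightarrow> real) set \<Rightarrow> ('k \<Rightarrow> real) set \<Rightarrow> bool" and K :: "'k topology"
  assumes R: "R \<in> {regular_sublattice, order_dense_sublattice}" and K: "compact_space K"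
begin

lemma regular_if_R: "R E (CK K) \<Longrightarrow> regular_sublattice E (CK K)"
  using R order_dense_imp_regular[OF _ CK_sup_0] by auto

lemma isometrically_embeds_imp_semicontinuous:
  assumes "isometrically_embeds TYPE('a::am_space) R K"
  shows "semicontinuous (norm :: 'a \<Rightarrow> real)"
proof -
  obtain T :: "'a \<Rightarrow> 'k \<Rightarrow> real" where T: "embedding K T" "\<And>f. sup_norm K (T f) = norm f" "R (range T) (CK K)"
    using assms unfolding isometrically_embeds_def by blast
  have "r_demicontinuous (1 / 1) (norm :: 'a \<Rightarrow> real)"
    by (rule r_demicontinuous_if_regular[OF K T(1) regular_if_R[OF T(3)]]) (simp_all add: T(2))
  then show ?thesis by (simp add: semicontinuous_def)
qed

lemma isomorphically_embeds_imp_demicontinuous: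
  assumes "isomorphically_embeds TYPE('a::am_space) R K"
  shows "demicontinuous (norm :: 'a \<Rightarrow> real)"
proof -
  obtain T :: "'a \<Rightarrow> 'k \<Rightarrow> real" and a b where T: "embedding K T" "R (range T) (CK K)"
    and ab: "0 < a" "0 < b" "\<And>f. a * norm f \<le> sup_norm K (T f)" "\<And>f. sup_norm K (T f) \<le> b * norm f"
    using assms unfolding isomorphically_embeds_def by blast
  have "r_demicontinuous (b / a) (norm :: 'a \<Rightarrow> real)"
    by (rule r_demicontinuous_if_regular[OF K T(1) regular_if_R[OF T(2)] ab])
  \<comment> \<open>Demicontinuity asks for a constant at least \<open>1\<close>; over the zero
    space \<open>a\<close> and \<open>b\<close> are unrelated and \<open>b / a\<close> may be
    smaller.\<close>
  then have "r_demicontinuous (max 1 (b / a)) (norm :: 'a \<Rightarrow> real)"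
    unfolding r_demicontinuous_def by (meson max.coboundedI2)
  then show ?thesis unfolding demicontinuous_def by (metis max.cobounded1)
qed

lemma injectively_embeds_imp_pointwise_demicontinuous:
  assumes "injectively_embeds TYPE('a::am_space) R K"
  shows "pointwise_demicontinuous (norm :: 'a \<Rightarrow> real)"
proof -
  obtain T :: "'a \<Rightarrow> 'k \<Rightarrow> real" where T: "embedding K T" "R (range T) (CK K)"
    using assms unfolding injectively_embeds_def by blast
  then show ?thesis using pointwise_demicontinuous_if_regular[OF K] regular_if_R by metis
qed

end

context
  fixes R :: "('a::am_space set set \<Rightarrow> real) set \<Rightarrow> ('a set set \<Rightarrow> real) set \<Rightarrow> bool"
  assumes R: "R \<in> {regular_sublattice, order_dense_sublattice}"
begin

lemma pointwise_demicontinuous_imp_R_rep: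
  "pointwise_demicontinuous (norm :: 'a \<Rightarrow> real) \<Longrightarrow> R (range (rep :: 'a \<Rightarrow> _)) (CK stone_space)"
  using R regular_rep order_dense_rep by auto

lemma pointwise_demicontinuous_imp_injectively_embeds:
  "pointwise_demicontinuous (norm :: 'a \<Rightarrow> real) \<Longrightarrow> injectively_embeds TYPE('a) R stone_space"
  unfolding injectively_embeds_def using embedding_rep pointwise_demicontinuous_imp_R_rep by blast

lemma demicontinuous_imp_isomorphically_embeds:
  assumes "demicontinuous (norm :: 'a \<Rightarrow> real)"
  shows "isomorphically_embeds TYPE('a) R stone_space"
proof -
  note pd = demicontinuous_imp_pointwise[OF assms]
  obtain r where r: "1 \<le> r" "r_demicontinuous r (norm :: 'a \<Rightarrow> real)"
    using assms unfolding demicontinuous_def by blast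
  have "1 / r * norm f \<le> sup_norm stone_space (rep f) \<and> sup_norm stone_space (rep f) \<le> 1 * norm f" for f :: 'a
    using norm_le_sup_norm_rep[OF r(2), of f] sup_norm_rep_le[of f] r(1) by (simp add: field_simps)
  moreover have "0 < 1 / r" using r(1) by simp
  ultimately show ?thesis
    unfolding isomorphically_embeds_def
    using embedding_rep[OF pd] pointwise_demicontinuous_imp_R_rep[OF pd] zero_less_one by blast
qed

lemma semicontinuous_imp_isometrically_embeds:
  assumes "semicontinuous (norm :: 'a \<Rightarrow> real)"
  shows "isometrically_embeds TYPE('a) R stone_space"
proof -
  note pd = demicontinuous_imp_pointwise[OF semicontinuous_imp_demicontinuous[OF assms]]
  have "sup_norm stone_space (rep f) = norm f" for f :: 'a
    using norm_le_sup_norm_rep[of 1 f] assms sup_norm_rep_le[of f] by (simp add: semicontinuous_def)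
  then show ?thesis
    unfolding isometrically_embeds_def
    using embedding_rep[OF pd] pointwise_demicontinuous_imp_R_rep[OF pd] by blast
qed

end

text \<open>In the norm pulled back from $C(K)$ the embedding is isometric, so regularity of its
  range gives the constant \<open>1 / 1\<close>; the two-sided bounds of the embedding are the
  equivalence of norms.\<close>

lemma demicontinuous_imp_topologically_semicontinuous:
  assumes "demicontinuous (norm :: 'a::am_space \<Rightarrow> real)"
  shows "topologically_semicontinuous (norm :: 'a \<Rightarrow> real)"
proof -
  obtain T :: "'a \<Rightarrow> 'a set set \<Rightarrow> real" and a b
    where T: "embedding stone_space T" "regular_sublattice (range T) (CK stone_space)"
      and ab: "0 < a" "0 < b"
        "\<And>f. a * norm f \<le> sup_norm stone_space (T f) \<and> sup_norm stone_space (T f) \<le> b * norm f"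
    using demicontinuous_imp_isomorphically_embeds[OF _ assms, of regular_sublattice]
    unfolding isomorphically_embeds_def by blast
  let ?M = "\<lambda>f. sup_norm stone_space (T f)"
  have "solid_norm ?M" by (rule solid_norm_sup_norm[OF compact_stone_space T(1)])
  moreover have "equivalent_norms norm ?M" unfolding equivalent_norms_def using ab by blast
  moreover have "r_demicontinuous (1 / 1) ?M"
    by (rule r_demicontinuous_if_regular[OF compact_stone_space T]) simp_all
  ultimately show ?thesis unfolding topologically_semicontinuous_def semicontinuous_def by auto
qed

text \<open>The forward direction always produces the Stone space, which is extremally disconnected,
  and the backward one uses compactness only, so both forms of each equivalence come at
  once.\<close>

lemma iff_ex_stone_space:
  fixes E :: "'a::lattice_ab_group_add_abs set set topology \<Rightarrow> bool"
  assumes "P \<Longrightarrow> E stone_space" "\<And>K. compact_space K \<Longrightarrow> E K \<Longrightarrow> P"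
  shows "P \<longleftrightarrow> (\<exists>K. compact_space K \<and> Hausdorff_space K \<and> E K)"
    and "P \<longleftrightarrow> (\<exists>K. compact_space K \<and> Hausdorff_space K \<and> extremally_disconnected K \<and> E K)"
  using assms compact_stone_space Hausdorff_stone_space extremally_disconnected_stone_space by metis+

lemma semicontinuous_iff_embeds:
  assumes R: "R \<in> {regular_sublattice, order_dense_sublattice}"
  shows "semicontinuous (norm :: 'a::am_space \<Rightarrow> real) \<longleftrightarrow>
      (\<exists>K :: 'a set set topology. compact_space K \<and> Hausdorff_space K \<and>
        isometrically_embeds TYPE('a) R K)"
    and "semicontinuous (norm :: 'a \<Rightarrow> real) \<longleftrightarrow>
      (\<exists>K :: 'a set set topology. compact_space K \<and> Hausdorff_space K \<and>
        extremally_disconnected K \<and> isometrically_embeds TYPE('a) R K)"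
  using iff_ex_stone_space[where E = "isometrically_embeds TYPE('a) R"]
    semicontinuous_imp_isometrically_embeds[OF R] isometrically_embeds_imp_semicontinuous[OF R]
  by metis+

lemma demicontinuous_iff_embeds:
  assumes R: "R \<in> {regular_sublattice, order_dense_sublattice}"
  shows "demicontinuous (norm :: 'a::am_space \<Rightarrow> real) \<longleftrightarrow>
      (\<exists>K :: 'a set set topology. compact_space K \<and> Hausdorff_space K \<and>
        isomorphically_embeds TYPE('a) R K)"
    and "demicontinuous (norm :: 'a \<Rightarrow> real) \<longleftrightarrow>
      (\<exists>K :: 'a set set topology. compact_space K \<and> Hausdorff_space K \<and>
        extremally_disconnected K \<and> isomorphically_embeds TYPE('a) R K)"
  using iff_ex_stone_space[where E = "isomorphically_embeds TYPE('a) R"]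
    demicontinuous_imp_isomorphically_embeds[OF R] isomorphically_embeds_imp_demicontinuous[OF R]
  by metis+

lemma pointwise_demicontinuous_iff_embeds:
  assumes R: "R \<in> {regular_sublattice, order_dense_sublattice}"
  shows "pointwise_demicontinuous (norm :: 'a::am_space \<Rightarrow> real) \<longleftrightarrow>
      (\<exists>K :: 'a set set topology. compact_space K \<and> Hausdorff_space K \<and>
        injectively_embeds TYPE('a) R K)"
    and "pointwise_demicontinuous (norm :: 'a \<Rightarrow> real) \<longleftrightarrow>
      (\<exists>K :: 'a set set topology. compact_space K \<and> Hausdorff_space K \<and>
        extremally_disconnected K \<and> injectively_embeds TYPE('a) R K)"
  using iff_ex_stone_space[where E = "injectively_embeds TYPE('a) R"]
    pointwise_demicontinuous_imp_injectively_embeds[OF R] injectively_embeds_imp_pointwise_demicontinuous[OF R]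
  by metis+

text \<open>The existence claims are tied to points in \<open>'a set set\<close>, where the Stone
  space lives; the last conjunct frees the converse implications from this type.\<close>

theorem theorem7p2:
  shows
    "(semicontinuous (norm :: 'a::am_space \<Rightarrow> real) \<longleftrightarrow>
        (\<exists>K :: 'a set set topology. compact_space K \<and> Hausdorff_space K \<and>
          isometrically_embeds TYPE('a) regular_sublattice K))
   \<and> (demicontinuous (norm :: 'a \<Rightarrow> real) \<longleftrightarrow>
        (\<exists>K :: 'a set set topology. compact_space K \<and> Hausdorff_space K \<and>
          isomorphically_embeds TYPE('a) regular_sublattice K))
   \<and> (demicontinuous (norm :: 'a \<Rightarrow> real) \<longrightarrow> topologically_semicontinuous (norm :: 'a \<Rightarrow> real))
   \<and> (pointwise_demicontinuous (norm :: 'a \<Rightarrow> real) \<longleftrightarrow>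
        (\<exists>K :: 'a set set topology. compact_space K \<and> Hausdorff_space K \<and>
          injectively_embeds TYPE('a) regular_sublattice K))

   \<and> (semicontinuous (norm :: 'a \<Rightarrow> real) \<longleftrightarrow>
        (\<exists>K :: 'a set set topology. compact_space K \<and> Hausdorff_space K \<and>
          isometrically_embeds TYPE('a) order_dense_sublattice K))
   \<and> (demicontinuous (norm :: 'a \<Rightarrow> real) \<longleftrightarrow>
        (\<exists>K :: 'a set set topology. compact_space K \<and> Hausdorff_space K \<and>
          isomorphically_embeds TYPE('a) order_dense_sublattice K))
   \<and> (pointwise_demicontinuous (norm :: 'a \<Rightarrow> real) \<longleftrightarrow>
        (\<exists>K :: 'a set set topology. compact_space K \<and> Hausdorff_space K \<and>
          injectively_embeds TYPE('a) order_dense_sublattice K))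

   \<and> (\<forall>R \<in> {regular_sublattice, order_dense_sublattice}.
        (semicontinuous (norm :: 'a \<Rightarrow> real) \<longleftrightarrow>
          (\<exists>K :: 'a set set topology. compact_space K \<and> Hausdorff_space K \<and>
            extremally_disconnected K \<and> isometrically_embeds TYPE('a) R K))
      \<and> (demicontinuous (norm :: 'a \<Rightarrow> real) \<longleftrightarrow>
          (\<exists>K :: 'a set set topology. compact_space K \<and> Hausdorff_space K \<and>
            extremally_disconnected K \<and> isomorphically_embeds TYPE('a) R K))
      \<and> (pointwise_demicontinuous (norm :: 'a \<Rightarrow> real) \<longleftrightarrow>
          (\<exists>K :: 'a set set topology. compact_space K \<and> Hausdorff_space K \<and>
            extremally_disconnected K \<and> injectively_embeds TYPE('a) R K)))

   \<and> (\<forall>R \<in> {regular_sublattice, order_dense_sublattice}.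
      \<forall>K :: 'k topology. compact_space K \<and> Hausdorff_space K \<longrightarrow>
        (isometrically_embeds TYPE('a) R K \<longrightarrow> semicontinuous (norm :: 'a \<Rightarrow> real))
      \<and> (isomorphically_embeds TYPE('a) R K \<longrightarrow> demicontinuous (norm :: 'a \<Rightarrow> real))
      \<and> (injectively_embeds TYPE('a) R K \<longrightarrow> pointwise_demicontinuous (norm :: 'a \<Rightarrow> real)))"
  by (intro conjI ballI allI impI; (elim conjE)?;
      (rule semicontinuous_iff_embeds demicontinuous_iff_embeds pointwise_demicontinuous_iff_embeds
        demicontinuous_imp_topologically_semicontinuous isometrically_embeds_imp_semicontinuous
        isomorphically_embeds_imp_demicontinuous injectively_embeds_imp_pointwise_demicontinuous;
        (assumption | simp; fail)))

end
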